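(* Every union-closed class of forests that is closed under taking topological minors is homomorphism distinguishing closed.
   Context: All graphs are finite, simple, undirected and loopless. $\hom(F,G)$ is the number of homomorphisms $F\to G$. Two graphs $G,H$ are homomorphism indistinguishable over a class $\mathcal{C}$, written $G\equiv_{\mathcal{C}}H$, if $\hom(F,G)=\hom(F,H)$ for all $F\in\mathcal{C}$. A graph class $\mathcal{C}$ is homomorphism distinguishing closed if for every graph $F'\notin\mathcal{C}$ there exist graphs $G,H$ with $G\equiv_{\mathcal{C}}H$ and $\hom(F',G)\neq\hom(F',H)$. A class is union-closed if it contains the disjoint union of any two of its members. A graph $M$ is a topological minor of $F$ if there is an injective map $\rho\colon V(M)\to V(F)$ and internally vertex-disjoint paths $(P_{vw})_{vw\in E(M)}$ in $F$ with $P_{vw}$ connecting $\rho(v)$ and $\rho(w)$. *)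

theory Defs
  imports "Graph_Theory.Graph_Theory" "HOL-Library.FuncSet"
begin

text \<open>
  An undirected edge \<open>vw\<close> of a graph is represented by the two arcs \<open>(v, w)\<close> and \<open>(w, v)\<close>
  of a symmetric loop-free digraph. Graphs have at least one vertex: the null graph has exactly one
  homomorphism into every graph, so if it counted as a graph, the empty class would not be
  homomorphism distinguishing closed.
\<close>

definition simple_graph :: "'a pair_pre_digraph \<Rightarrow> bool" where
  "simple_graph G \<longleftrightarrow> pair_graph G \<and> pverts G \<noteq> {}"

definition homs :: "'a pair_pre_digraph \<Rightarrow> 'b pair_pre_digraph \<Rightarrow> ('a \<Rightarrow> 'b) set" where
  "homs F G = {f \<in> pverts F \<rightarrow>\<^sub>E pverts G. \<forall>(u, v) \<in> parcs F. (f u, f v) \<in> parcs G}"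

definition hom_count :: "'a pair_pre_digraph \<Rightarrow> 'b pair_pre_digraph \<Rightarrow> nat" where
  "hom_count F G = card (homs F G)"

text \<open>
  A graph class is a set of graphs on natural numbers; every finite graph has an isomorphic copy
  there.
\<close>

definition hom_indistinguishable ::
  "nat pair_pre_digraph set \<Rightarrow> nat pair_pre_digraph \<Rightarrow> nat pair_pre_digraph \<Rightarrow> bool" where
  "hom_indistinguishable C G H \<longleftrightarrow> (\<forall>F \<in> C. hom_count F G = hom_count F H)"

definition hom_distinguishing_closed :: "nat pair_pre_digraph set \<Rightarrow> bool" where
  "hom_distinguishing_closed C \<longleftrightarrow>
    (\<forall>F. simple_graph F \<and> F \<notin> C \<longrightarrow>
      (\<exists>G H. simple_graph G \<and> simple_graph H \<and>
        hom_indistinguishable C G H \<and> hom_count F G \<noteq> hom_count F H))"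

definition disjoint_union ::
  "'a pair_pre_digraph \<Rightarrow> 'b pair_pre_digraph \<Rightarrow> ('a + 'b) pair_pre_digraph" where
  "disjoint_union F G =
    \<lparr> pverts = pverts F <+> pverts G,
      parcs = map_prod Inl Inl ` parcs F \<union> map_prod Inr Inr ` parcs G \<rparr>"

text \<open>
  The disjoint union lives on a sum type, so membership in the class refers to its copies on
  natural numbers.
\<close>

definition union_closed :: "nat pair_pre_digraph set \<Rightarrow> bool" where
  "union_closed C \<longleftrightarrow>
    (\<forall>F1 \<in> C. \<forall>F2 \<in> C. \<forall>F. digraph_iso (with_proj (disjoint_union F1 F2)) (with_proj F) \<longrightarrow> F \<in> C)"

text \<open>
  The predicate \<open>forest\<close> of \<open>Graph_Theory\<close> is not usable for symmetric digraphs, where every edge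
  yields a closed walk \<open>v, w, v\<close> that counts as a cycle of length two; cycles of an undirected
  graph have length at least three.
\<close>

definition forest_graph :: "'a pair_pre_digraph \<Rightarrow> bool" where
  "forest_graph F \<longleftrightarrow>
    simple_graph F \<and> \<not> (\<exists>p. pre_digraph.cycle (with_proj F) p \<and> length p \<ge> 3)"

text \<open>
  The condition on \<open>rev_path\<close> makes \<open>P\<close> a family indexed by undirected edges: both
  orientations of an edge of \<open>M\<close> are assigned the same path, traversed in opposite directions. Internally
  disjoint means that no inner vertex of one path lies on another path. So only the image of an
  isolated vertex of \<open>M\<close> may be an inner vertex of a path; for union-closed classes, forbidding
  this as well gives the same notion of closure.
\<close>

definition topological_minor :: "'a pair_pre_digraph \<Rightarrow> 'b pair_pre_digraph \<Rightarrow> bool" where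
  "topological_minor M F \<longleftrightarrow>
    (\<exists>\<rho> P. inj_on \<rho> (pverts M) \<and> \<rho> ` pverts M \<subseteq> pverts F \<and>
      (\<forall>(v, w) \<in> parcs M.
        pre_digraph.apath (with_proj F) (\<rho> v) (P (v, w)) (\<rho> w) \<and>
        P (w, v) = rev_path (P (v, w))) \<and>
      (\<forall>(v, w) \<in> parcs M. \<forall>(x, y) \<in> parcs M. {v, w} \<noteq> {x, y} \<longrightarrow>
        set (pre_digraph.inner_verts (with_proj F) (P (v, w))) \<inter>
        set (pre_digraph.awalk_verts (with_proj F) (\<rho> x) (P (x, y))) = {}))"

definition topological_minor_closed :: "nat pair_pre_digraph set \<Rightarrow> bool" where
  "topological_minor_closed C \<longleftrightarrow>
    (\<forall>F \<in> C. \<forall>M. simple_graph M \<and> topological_minor M F \<longrightarrow> M \<in> C)"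

end

theory Submission
  imports Defs "HOL-Library.Nat_Bijection"
begin

text \<open>
  For a graph \<open>F\<close> outside the class, compare the Cai-Fuerer-Immerman graph of \<open>F\<close> with its twist at
  one vertex \<open>s\<close>. The homomorphisms from \<open>F'\<close> to the twisted graph that lie over a fixed
  homomorphism \<open>\<phi>\<close> from \<open>F'\<close> to \<open>F\<close> are the solutions of a linear system over the field with two
  elements, and those to the untwisted graph solve the homogeneous system. So the two counts agree
  whenever all these systems are solvable, and they differ for \<open>F' = F\<close> because the system over the
  identity is unsolvable by the handshake lemma.

  Let \<open>F'\<close> be a forest. If \<open>F\<close> contains a cycle through \<open>s\<close>, the system can be solved greedily
  along \<open>F'\<close>, since at each vertex over the cycle there is a second cycle edge whose value is still
  free. If \<open>F\<close> is a forest, some component \<open>K\<close> of \<open>F\<close> is not in the class, and \<open>s\<close> is chosen in \<open>K\<close>.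
  A branch of \<open>F'\<close> can force the value of the edge through which it is entered only if it
  topologically contains one of the two parts into which the image of that edge splits \<open>K\<close>; the
  forced value tells which one, because exactly one of the parts contains \<open>s\<close>. Conflicting forced
  values therefore assemble a subdivision of \<open>K\<close> in \<open>F'\<close>, which is impossible for \<open>F'\<close> in the class,
  and without conflicts the system is solvable.
\<close>

section \<open>Branches of forests\<close>

text \<open>For an arc \<open>(a, b)\<close> of a forest this is the part lying beyond the edge
  \<open>ab\<close>, seen from \<open>a\<close>. Removing the vertex \<open>a\<close> instead of the
  edge turns membership into plain reachability.\<close>

definition branch :: "'a rel \<Rightarrow> 'a \<Rightarrow> 'a \<Rightarrow> 'a set" where
  "branch E a b = {y. (b, y) \<in> {(p, q) \<in> E. p \<noteq> a \<and> q \<noteq> a}\<^sup>*}"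

lemma branch_root: "b \<in> branch E a b"
  by (simp add: branch_def)

lemma branch_step: "y \<in> branch E a b \<Longrightarrow> (y, z) \<in> E \<Longrightarrow> y \<noteq> a \<Longrightarrow> z \<noteq> a \<Longrightarrow> z \<in> branch E a b"
  unfolding branch_def by (auto intro: rtrancl_into_rtrancl)

lemma branch_induct [consumes 1, case_names root step]:
  assumes "y \<in> branch E a b" and "P b"
    and "\<And>y z. y \<in> branch E a b \<Longrightarrow> P y \<Longrightarrow> (y, z) \<in> E \<Longrightarrow> y \<noteq> a \<Longrightarrow> z \<noteq> a \<Longrightarrow> P z"
  shows "P y"
proof -
  have "(b, y) \<in> {(p, q) \<in> E. p \<noteq> a \<and> q \<noteq> a}\<^sup>*"
    using assms(1) by (simp add: branch_def)
  then show ?thesis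
  proof (induction rule: rtrancl_induct)
    case base
    then show ?case by (rule assms(2))
  next
    case (step y z)
    then show ?case using assms(3)[of y z] by (auto simp: branch_def)
  qed
qed

lemma branch_mono: "E \<subseteq> E' \<Longrightarrow> branch E a b \<subseteq> branch E' a b"
  unfolding branch_def by (auto elim!: rtrancl_mono[THEN subsetD, rotated])

text \<open>Acyclicity is put locally: distinct neighbours of \<open>b\<close> cannot reach each
  other once \<open>b\<close> is removed. This is the form that inductions over branches need;
  \<open>exists_cycle\<close> recovers a genuine cycle when it fails.\<close>

locale forest_rel =
  fixes E :: "'a rel"
  assumes fin: "finite E"
    and symm: "(a, b) \<in> E \<Longrightarrow> (b, a) \<in> E"
    and no_loop: "(a, b) \<in> E \<Longrightarrow> a \<noteq> b"
    and acyclic: "(b, c) \<in> E \<Longrightarrow> (b, d) \<in> E \<Longrightarrow> d \<in> branch E b c \<Longrightarrow> d = c"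
begin

lemma branch_avoids: "(a, b) \<in> E \<Longrightarrow> y \<in> branch E a b \<Longrightarrow> y \<noteq> a"
  by (erule branch_induct) (auto dest: no_loop)

lemma branch_disjoint:
  assumes "(b, c) \<in> E" "(b, d) \<in> E" "c \<noteq> d"
  shows "branch E b c \<inter> branch E b d = {}"
proof -
  have "y \<notin> branch E b d" if "y \<in> branch E b c" for y
    using that
  proof (induction rule: branch_induct)
    case root
    then show ?case using acyclic[OF assms(2,1)] assms(3) by blast
  next
    case (step y z)
    then show ?case using branch_step[of z E b d y] symm by blast
  qed
  then show ?thesis by blast
qed

lemma branch_subset:
  assumes "(a, b) \<in> E" "(b, c) \<in> E" "c \<noteq> a"
  shows "branch E b c \<subseteq> branch E a b"
proof
  have a: "a \<notin> branch E b c"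
    using acyclic[OF assms(2) symm[OF assms(1)]] assms(3) by blast
  fix y assume "y \<in> branch E b c"
  then have "y \<in> branch E b c \<and> y \<in> branch E a b"
  proof (induction rule: branch_induct)
    case root
    then show ?case
      using branch_step[OF branch_root assms(2)] no_loop[OF assms(1)] assms(3)
      by (auto intro: branch_root)
  next
    case (step y z)
    then have "z \<in> branch E b c" using branch_step by metis
    with step a show ?case using branch_step[of y E a b z] by metis
  qed
  then show "y \<in> branch E a b" by blast
qed

lemma branch_decomp:
  assumes "(a, b) \<in> E"
  shows "branch E a b = insert b (\<Union>c \<in> {c. (b, c) \<in> E \<and> c \<noteq> a}. branch E b c)"
proof
  show "branch E a b \<subseteq> insert b (\<Union>c \<in> {c. (b, c) \<in> E \<and> c \<noteq> a}. branch E b c)"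
  proof
    fix y assume "y \<in> branch E a b"
    then show "y \<in> insert b (\<Union>c \<in> {c. (b, c) \<in> E \<and> c \<noteq> a}. branch E b c)"
    proof (induction rule: branch_induct)
      case root
      then show ?case by simp
    next
      case (step y z)
      then show ?case using branch_root[of z E b] branch_step[of y E b _ z] by blast
    qed
  qed
  show "insert b (\<Union>c \<in> {c. (b, c) \<in> E \<and> c \<noteq> a}. branch E b c) \<subseteq> branch E a b"
    using branch_subset[OF assms] branch_root[of b E a] by blast
qed

lemma branch_opposite_disjoint:
  assumes "(a, b) \<in> E"
  shows "branch E a b \<inter> branch E b a = {}"
proof -
  have "y \<notin> branch E b a" if "y \<in> branch E a b" for y
    using that unfolding branch_decomp[OF assms]
    using branch_disjoint[OF _ symm[OF assms]] branch_avoids[OF symm[OF assms]]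
    by blast
  then show ?thesis by blast
qed

lemma finite_branch: "finite (branch E a b)"
proof -
  have "branch E a b \<subseteq> insert b (snd ` E)"
  proof
    fix y assume "y \<in> branch E a b"
    then show "y \<in> insert b (snd ` E)"
      by (induction rule: branch_induct) force+
  qed
  then show ?thesis using fin finite_subset by blast
qed

text \<open>Among the arcs inside \<open>S\<close>, take one whose branch is smallest. A second
  neighbour of its head in \<open>S\<close> would give an arc with a strictly smaller
  branch.\<close>

lemma exists_leaf:
  assumes "S \<noteq> {}"
  shows "\<exists>b \<in> S. \<exists>a. \<forall>c \<in> S. (b, c) \<in> E \<longrightarrow> c = a"
proof (cases "\<exists>a \<in> S. \<exists>b \<in> S. (a, b) \<in> E")
  case False
  then show ?thesis using assms by blast
next
  case True
  define P where "P = (\<lambda>(a, b). a \<in> S \<and> b \<in> S \<and> (a, b) \<in> E)"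
  have "\<exists>e. P e" using True by (auto simp: P_def)
  then obtain e where e: "P e"
    and min: "\<And>e'. P e' \<Longrightarrow> card (case_prod (branch E) e) \<le> card (case_prod (branch E) e')"
    using ex_has_least_nat[where P = P and m = "\<lambda>e. card (case_prod (branch E) e)"] by metis
  obtain a b where ab: "e = (a, b)" by (cases e)
  have "c = a" if c: "c \<in> S" "(b, c) \<in> E" for c
  proof (rule ccontr)
    assume "c \<noteq> a"
    with e ab c have "branch E b c \<subseteq> branch E a b"
      by (auto simp: P_def intro: branch_subset[THEN subsetD])
    moreover have "b \<in> branch E a b" "b \<notin> branch E b c"
      using branch_avoids[OF c(2)] by (auto intro: branch_root)
    ultimately have "card (branch E b c) < card (branch E a b)"
      by (metis finite_branch psubsetI psubset_card_mono)
    moreover have "card (branch E a b) \<le> card (branch E b c)"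
      using min[of "(b, c)"] e ab c by (auto simp: P_def)
    ultimately show False by simp
  qed
  then show ?thesis using e ab by (auto simp: P_def)
qed

text \<open>Greedy construction along a forest: peel off a leaf, solve the rest, then choose a value
  at the leaf. \<open>I a y c\<close> records that the value \<open>y\<close> at \<open>a\<close>
  can still be extended across the arc to \<open>c\<close>; it is maintained for all arcs that leave
  the part already treated.\<close>

lemma propagate:
  fixes Adm :: "'a \<Rightarrow> 'x \<Rightarrow> bool"
  assumes "finite V"
    and root: "\<And>b. b \<in> V \<Longrightarrow> \<exists>x. Adm b x \<and> (\<forall>c. (b, c) \<in> E \<longrightarrow> I b x c)"
    and step: "\<And>a b y. (a, b) \<in> E \<Longrightarrow> Adm a y \<Longrightarrow> I a y b \<Longrightarrow>
      \<exists>x. Adm b x \<and> Cmp a y b x \<and> (\<forall>c. (b, c) \<in> E \<longrightarrow> c \<noteq> a \<longrightarrow> I b x c)"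
    and Cmp: "\<And>a y b x. Cmp a y b x \<Longrightarrow> Cmp b x a y"
  shows "\<exists>f. (\<forall>b \<in> V. Adm b (f b)) \<and> (\<forall>a \<in> V. \<forall>b \<in> V. (a, b) \<in> E \<longrightarrow> Cmp a (f a) b (f b))"
proof -
  have "\<exists>f. (\<forall>b \<in> S. Adm b (f b)) \<and> (\<forall>a \<in> S. \<forall>b \<in> S. (a, b) \<in> E \<longrightarrow> Cmp a (f a) b (f b))
      \<and> (\<forall>a \<in> S. \<forall>c. c \<notin> S \<longrightarrow> (a, c) \<in> E \<longrightarrow> I a (f a) c)"
    if "S \<subseteq> V" for S
    using finite_subset[OF that \<open>finite V\<close>] that
  proof (induction S rule: finite_psubset_induct)
    case (psubset S)
    show ?case
    proof (cases "S = {}")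
      case True
      then show ?thesis by simp
    next
      case False
      then obtain b a where b: "b \<in> S" and leaf: "\<And>c. c \<in> S \<Longrightarrow> (b, c) \<in> E \<Longrightarrow> c = a"
        using exists_leaf by metis
      have "S - {b} \<subset> S" "S - {b} \<subseteq> V" using psubset.prems b by auto
      from psubset.IH[OF this] obtain f where f: "\<forall>c \<in> S - {b}. Adm c (f c)"
        "\<forall>c \<in> S - {b}. \<forall>d \<in> S - {b}. (c, d) \<in> E \<longrightarrow> Cmp c (f c) d (f d)"
        "\<forall>c \<in> S - {b}. \<forall>d. d \<notin> S - {b} \<longrightarrow> (c, d) \<in> E \<longrightarrow> I c (f c) d"
        by (elim exE conjE)
      have f1: "\<And>c. c \<in> S - {b} \<Longrightarrow> Adm c (f c)"
        and f2: "\<And>c d. c \<in> S - {b} \<Longrightarrow> d \<in> S - {b} \<Longrightarrow> (c, d) \<in> E \<Longrightarrow> Cmp c (f c) d (f d)"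
        and f3: "\<And>c d. c \<in> S - {b} \<Longrightarrow> d \<notin> S - {b} \<Longrightarrow> (c, d) \<in> E \<Longrightarrow> I c (f c) d"
        using f by simp_all
      \<comment> \<open>The leaf \<open>b\<close> has at most one treated neighbour. If there is
        one, the invariant on the arc leading to \<open>b\<close> permits \<open>step\<close>;
        otherwise \<open>b\<close> starts afresh with \<open>root\<close>.\<close>
      have "\<exists>x. Adm b x \<and> (\<forall>c. (b, c) \<in> E \<longrightarrow> c \<notin> S \<longrightarrow> I b x c) \<and>
          (\<forall>c \<in> S. (b, c) \<in> E \<longrightarrow> Cmp c (f c) b x)"
      proof (cases "a \<in> S \<and> (b, a) \<in> E")
        case True
        then have a: "a \<in> S - {b}" "(a, b) \<in> E" using symm no_loop by auto
        then show ?thesis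
          using step[OF a(2) f1[OF a(1)] f3[OF a(1) _ a(2)]] leaf True by blast
      next
        case False
        then show ?thesis using root[of b] psubset.prems b leaf by blast
      qed
      then obtain x where x: "Adm b x" "\<And>c. (b, c) \<in> E \<Longrightarrow> c \<notin> S \<Longrightarrow> I b x c"
        "\<And>c. c \<in> S \<Longrightarrow> (b, c) \<in> E \<Longrightarrow> Cmp c (f c) b x" by blast
      show ?thesis
        using f1 f2 f3 x b
        by (intro exI[of _ "f(b := x)"]) (auto dest: no_loop symm intro: Cmp)
    qed
  qed
  then show ?thesis by blast
qed

end

lemma forest_rel_subset:
  assumes "forest_rel E" "E' \<subseteq> E" "\<And>a b. (a, b) \<in> E' \<Longrightarrow> (b, a) \<in> E'"
  shows "forest_rel E'"
proof -
  interpret forest_rel E by fact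
  show ?thesis
  proof
    show "finite E'" using assms(2) fin finite_subset by blast
    show "d = c" if "(b, c) \<in> E'" "(b, d) \<in> E'" "d \<in> branch E' b c" for b c d
      using that assms(2) acyclic[of b c d] branch_mono[OF assms(2), of b c] by blast
  qed (use assms(2,3) no_loop in blast)+
qed

section \<open>Paths as vertex lists, and cycles in relations that are not forests\<close>

definition path :: "'a rel \<Rightarrow> 'a \<Rightarrow> 'a list \<Rightarrow> 'a \<Rightarrow> bool" where
  "path E a p b \<longleftrightarrow> p \<noteq> [] \<and> hd p = a \<and> last p = b \<and> distinct p \<and> successively (\<lambda>x y. (x, y) \<in> E) p"

lemma rtrancl_path:
  assumes "(a, b) \<in> E\<^sup>*"
  shows "\<exists>p. path E a p b"
  using assms
proof (induction rule: rtrancl_induct)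
  case base
  then show ?case by (intro exI[of _ "[a]"]) (simp add: path_def)
next
  case (step b c)
  then obtain p where p: "path E a p b" by blast
  show ?case
  proof (cases "c \<in> set p")
    case False
    then show ?thesis using p step.hyps
      by (intro exI[of _ "p @ [c]"]) (auto simp: path_def successively_append_iff)
  next
    case True
    then obtain q r where "p = (q @ [c]) @ r" using split_list[OF True] by force
    moreover from this have "successively (\<lambda>x y. (x, y) \<in> E) (q @ [c])"
      using p unfolding path_def by (simp only: successively_append_iff)
    ultimately show ?thesis using p unfolding path_def
      by (intro exI[of _ "q @ [c]"]) (cases q; auto)
  qed
qed

text \<open>A violation of acyclicity gives two neighbours of \<open>b\<close> joined by a path
  \<open>p\<close> that avoids \<open>b\<close>, and \<open>b\<close> closes it up. Distinct ends of
  \<open>p\<close> say that the cycle has length at least three.\<close>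

lemma exists_cycle:
  assumes "finite E" "\<And>a b. (a, b) \<in> E \<Longrightarrow> (b, a) \<in> E" "\<And>a b. (a, b) \<in> E \<Longrightarrow> a \<noteq> b"
    and "\<not> forest_rel E"
  shows "\<exists>b p. p \<noteq> [] \<and> hd p \<noteq> last p \<and> distinct (b # p) \<and> successively (\<lambda>x y. (x, y) \<in> E) (b # p @ [b])"
proof -
  obtain b c d where bcd: "(b, c) \<in> E" "(b, d) \<in> E" "d \<in> branch E b c" "d \<noteq> c"
    using assms unfolding forest_rel_def by blast
  then obtain p where p: "path {(p, q) \<in> E. p \<noteq> b \<and> q \<noteq> b} c p d"
    using rtrancl_path unfolding branch_def by fastforce
  have "y \<noteq> b" if "y \<in> set p" for y
  proof -
    have "(c, y) \<in> {(p, q) \<in> E. p \<noteq> b \<and> q \<noteq> b}\<^sup>*" if "path {(p, q) \<in> E. p \<noteq> b \<and> q \<noteq> b} c p d" "y \<in> set p" for p c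
      using that
    proof (induction p arbitrary: c)
      case (Cons x p)
      then show ?case
        by (cases p) (auto simp: path_def intro: converse_rtrancl_into_rtrancl)
    qed (simp add: path_def)
    then have "y \<in> branch E b c" using p that by (simp add: branch_def)
    then show ?thesis using assms(3)[OF bcd(1)] by (induction rule: branch_induct) auto
  qed
  then have "b \<notin> set p" by blast
  moreover have "successively (\<lambda>x y. (x, y) \<in> E) p"
    using p unfolding path_def by (auto elim: successively_mono)
  moreover have "p \<noteq> []" "hd p = c" "last p = d" "distinct p"
    using p by (auto simp: path_def)
  ultimately show ?thesis
    using bcd assms(2)
    by (intro exI[of _ b] exI[of _ p]) (simp add: successively_append_iff successively_Cons)
qed

section \<open>Topological embeddings into forests\<close>

lemma path_rev:
  assumes "\<And>a b. (a, b) \<in> E \<Longrightarrow> (b, a) \<in> E" "path E a p b"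
  shows "path E b (rev p) a"
proof -
  have "successively (\<lambda>x y. (y, x) \<in> E) p"
    using assms unfolding path_def by (auto elim: successively_mono)
  then show ?thesis
    using assms(2) unfolding path_def by (simp add: hd_rev last_rev)
qed

text \<open>A subdivision, inside \<open>E\<close>, of the graph that \<open>A\<close> induces on
  \<open>D\<close>. Disjointness is expressed on whole paths, which may meet only in images of
  common end vertices; this form survives gluing and restriction.\<close>

definition top_emb :: "'t rel \<Rightarrow> 'k rel \<Rightarrow> 'k set \<Rightarrow> ('k \<Rightarrow> 't) \<Rightarrow> ('k \<Rightarrow> 'k \<Rightarrow> 't list) \<Rightarrow> bool" where
  "top_emb E A D \<rho> P \<longleftrightarrow> inj_on \<rho> D \<and>
    (\<forall>x \<in> D. \<forall>y \<in> D. (x, y) \<in> A \<longrightarrow> path E (\<rho> x) (P x y) (\<rho> y) \<and> P y x = rev (P x y)) \<and>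
    (\<forall>x \<in> D. \<forall>y \<in> D. \<forall>x' \<in> D. \<forall>y' \<in> D. (x, y) \<in> A \<longrightarrow> (x', y') \<in> A \<longrightarrow> {x, y} \<noteq> {x', y'} \<longrightarrow>
      set (P x y) \<inter> set (P x' y') \<subseteq> \<rho> ` ({x, y} \<inter> {x', y'}))"

lemma top_embD:
  assumes "top_emb E A D \<rho> P" "x \<in> D" "y \<in> D" "(x, y) \<in> A"
  shows "path E (\<rho> x) (P x y) (\<rho> y)" "P y x = rev (P x y)"
    and "x' \<in> D \<Longrightarrow> y' \<in> D \<Longrightarrow> (x', y') \<in> A \<Longrightarrow> {x, y} \<noteq> {x', y'} \<Longrightarrow>
      set (P x y) \<inter> set (P x' y') \<subseteq> \<rho> ` ({x, y} \<inter> {x', y'})"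
  using assms unfolding top_emb_def by blast+

lemma top_emb_subset:
  assumes "top_emb E A D \<rho> P" "D' \<subseteq> D"
  shows "top_emb E A D' \<rho> P"
  using assms(1) subsetD[OF assms(2)] inj_on_subset[OF _ assms(2), of \<rho>] unfolding top_emb_def
  by simp

text \<open>Adds a vertex \<open>v\<close> hanging at \<open>w\<close>, with \<open>Q\<close> as the
  path of the new edge. It serves to give an embedded branch its entry vertex, or to move that entry
  vertex further out.\<close>

lemma top_emb_attach:
  assumes emb: "top_emb E A D \<rho> P" and v: "v \<notin> D" "w \<in> D"
    and A: "\<And>x y. (x, y) \<in> A \<Longrightarrow> (y, x) \<in> A" "\<And>x. x \<in> insert v D \<Longrightarrow> (v, x) \<in> A \<Longrightarrow> x = w"
    and E: "\<And>x y. (x, y) \<in> E \<Longrightarrow> (y, x) \<in> E"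
    and a: "a \<notin> \<rho> ` D" and Q: "path E a Q (\<rho> w)"
    and disj: "\<And>x y. x \<in> D \<Longrightarrow> y \<in> D \<Longrightarrow> (x, y) \<in> A \<Longrightarrow> set Q \<inter> set (P x y) \<subseteq> \<rho> ` ({w} \<inter> {x, y})"
    and P': "\<And>x y. P' x y = (if x = v then Q else if y = v then rev Q else P x y)"
  shows "top_emb E A (insert v D) (\<rho>(v := a)) P'"
proof -
  have arcs: "(x = v \<and> y = w) \<or> (x = w \<and> y = v) \<or> (x \<in> D \<and> y \<in> D)"
    if "x \<in> insert v D" "y \<in> insert v D" "(x, y) \<in> A" for x y
    using that A by blast
  have vw: "v \<noteq> w" using v by blast
  have inj: "inj_on (\<rho>(v := a)) (insert v D)"
    using emb a v unfolding top_emb_def inj_on_def by auto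
  have paths: "path E ((\<rho>(v := a)) x) (P' x y) ((\<rho>(v := a)) y) \<and> P' y x = rev (P' x y)"
    if "x \<in> insert v D" "y \<in> insert v D" "(x, y) \<in> A" for x y
    using arcs[OF that] v vw Q path_rev[OF E Q] top_embD(1,2)[OF emb _ _ that(3)]
    by (auto simp: P')
  have sets: "set (P' x y) = (if v \<in> {x, y} then set Q else set (P x y))" for x y
    by (simp add: P')
  have \<rho>D: "(\<rho>(v := a)) ` S = \<rho> ` S" if "S \<subseteq> D" for S
    using that v by (auto simp: image_iff)
  have "set (P' x y) \<inter> set (P' x' y') \<subseteq> (\<rho>(v := a)) ` ({x, y} \<inter> {x', y'})"
    if xy: "x \<in> insert v D" "y \<in> insert v D" "(x, y) \<in> A"
      and xy': "x' \<in> insert v D" "y' \<in> insert v D" "(x', y') \<in> A" and ne: "{x, y} \<noteq> {x', y'}"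
    for x y x' y'
  proof -
    consider "{x, y} = {v, w}" "x' \<in> D" "y' \<in> D" | "{x', y'} = {v, w}" "x \<in> D" "y \<in> D"
      | "x \<in> D" "y \<in> D" "x' \<in> D" "y' \<in> D"
      using arcs[OF xy] arcs[OF xy'] ne by blast
    then show ?thesis
    proof cases
      case 1
      then have "set (P' x y) = set Q" "set (P' x' y') = set (P x' y')"
        using v by (auto simp: sets)
      moreover have "{x, y} \<inter> {x', y'} = {w} \<inter> {x', y'}" using 1 v by auto
      moreover have "(\<rho>(v := a)) ` ({w} \<inter> {x', y'}) = \<rho> ` ({w} \<inter> {x', y'})"
        by (rule \<rho>D) (use v in blast)
      ultimately show ?thesis using disj[OF 1(2,3) xy'(3)] by argo
    next
      case 2
      then have "set (P' x' y') = set Q" "set (P' x y) = set (P x y)"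
        using v by (auto simp: sets)
      moreover have "{x, y} \<inter> {x', y'} = {w} \<inter> {x, y}" using 2 v by auto
      moreover have "(\<rho>(v := a)) ` ({w} \<inter> {x, y}) = \<rho> ` ({w} \<inter> {x, y})"
        by (rule \<rho>D) (use v in blast)
      ultimately show ?thesis using disj[OF 2(2,3) xy(3)] by (metis Int_commute)
    next
      case 3
      then have "set (P' x' y') = set (P x' y')" "set (P' x y) = set (P x y)"
        using v by (auto simp: sets)
      moreover have "(\<rho>(v := a)) ` ({x, y} \<inter> {x', y'}) = \<rho> ` ({x, y} \<inter> {x', y'})"
        by (rule \<rho>D) (use 3 in blast)
      ultimately show ?thesis
        using top_embD(3)[OF emb 3(1,2) xy(3) 3(3,4) xy'(3) ne] by argo
    qed
  qed
  then show ?thesis using inj paths unfolding top_emb_def by blast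
qed

text \<open>
  \<open>emb A E v w a b\<close> says that the branch of the forest \<open>A\<close> entered through the arc \<open>(v, w)\<close> embeds
  topologically into the branch of the forest \<open>E\<close> entered through \<open>(a, b)\<close>, in such a way that the
  image of \<open>w\<close> is the vertex closest to \<open>a\<close>.
\<close>

inductive emb :: "'k rel \<Rightarrow> 't rel \<Rightarrow> 'k \<Rightarrow> 'k \<Rightarrow> 't \<Rightarrow> 't \<Rightarrow> bool" for A E where
  extend: "(a, b) \<in> E \<Longrightarrow> (b, c) \<in> E \<Longrightarrow> c \<noteq> a \<Longrightarrow> emb A E v w b c \<Longrightarrow> emb A E v w a b"
| node: "(a, b) \<in> E \<Longrightarrow> (v, w) \<in> A \<Longrightarrow> inj_on g {u. (w, u) \<in> A \<and> u \<noteq> v} \<Longrightarrow>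
    (\<And>u. (w, u) \<in> A \<Longrightarrow> u \<noteq> v \<Longrightarrow> (b, g u) \<in> E \<and> g u \<noteq> a \<and> emb A E w u b (g u)) \<Longrightarrow>
    emb A E v w a b"

definition full_emb :: "'k rel \<Rightarrow> 't rel \<Rightarrow> 'k \<Rightarrow> 't \<Rightarrow> bool" where
  "full_emb A E w b \<longleftrightarrow>
    (\<exists>g. inj_on g {u. (w, u) \<in> A} \<and> (\<forall>u. (w, u) \<in> A \<longrightarrow> (b, g u) \<in> E \<and> emb A E w u b (g u)))"

section \<open>Embedded branches and pairs of opposite branches\<close>

lemma emb_arcs: "emb A E v w a b \<Longrightarrow> (v, w) \<in> A \<and> (a, b) \<in> E"
  by (induction rule: emb.induct) auto

text \<open>The branch beyond \<open>(w, v)\<close> is part of the branch beyond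
  \<open>(u, w)\<close>. Following the embedding down to the image of \<open>w\<close> and one arc
  further reaches it; the arcs passed on the way are absorbed by \<open>extend\<close>.\<close>

lemma emb_sub_branch:
  assumes "emb A E u w a b" "(w, v) \<in> A" "v \<noteq> u"
  shows "emb A E w v a b"
  using assms
proof (induction rule: emb.induct)
  case (extend a b c u w)
  show ?case by (rule emb.extend[OF extend.hyps(1-3) extend.IH[OF extend.prems]])
next
  case (node a b u w g)
  then have "(b, g v) \<in> E" "g v \<noteq> a" "emb A E w v b (g v)" by auto
  then show ?case by (rule emb.extend[OF node.hyps(1)])
qed

locale forest_pair = T: forest_rel E + K: forest_rel A
  for E :: "'t rel" and A :: "'k rel"
begin

text \<open>The arc \<open>(a, b)\<close> is moved forward until \<open>b\<close> is the image of
  \<open>w\<close>; each move lengthens the opposite embedding by one arc. There the branches at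
  \<open>w\<close> other than that of \<open>u\<close> already have their places, and the branch of
  \<open>u\<close> goes back through \<open>a\<close>.\<close>

lemma emb_opposite:
  assumes "emb A E u w a b" "emb A E w u b a"
  shows "\<exists>w b. w \<in> fst ` A \<and> b \<in> fst ` E \<and> full_emb A E w b"
  using assms
proof (induction rule: emb.induct)
  case (extend a b c u w)
  have "emb A E w u c b"
    by (rule emb.extend[OF T.symm T.symm]) (use extend in auto)
  then show ?case by (rule extend.IH)
next
  case (node a b u w g)
  have "inj_on (g(u := a)) {x. (w, x) \<in> A}"
    using node.hyps(3) node.IH unfolding inj_on_def by auto
  moreover have "(b, (g(u := a)) x) \<in> E \<and> emb A E w x b ((g(u := a)) x)" if "(w, x) \<in> A" for x
    using node.IH[OF that] node.prems T.symm[OF node.hyps(1)] by (cases "x = u") simp_all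
  ultimately have "full_emb A E w b"
    unfolding full_emb_def by blast
  moreover have "w \<in> fst ` A" "b \<in> fst ` E"
    using K.symm[OF node.hyps(2)] T.symm[OF node.hyps(1)] by force+
  ultimately show ?case by blast
qed

text \<open>Seen from \<open>c\<close>, the embedding behind \<open>d\<close> lies beyond
  \<open>(c, b)\<close>, which leads back to two opposite arcs.\<close>

lemma emb_both_sides:
  assumes "emb A E u w b c" "emb A E w u b d" "c \<noteq> d"
  shows "\<exists>w b. w \<in> fst ` A \<and> b \<in> fst ` E \<and> full_emb A E w b"
proof -
  have "emb A E w u c b"
    using assms emb.extend[of c b E d] T.symm emb_arcs by metis
  then show ?thesis using emb_opposite assms(1) by blast
qed

text \<open>The explicit subdivision behind \<open>emb\<close>. It includes the entry vertex
  \<open>v\<close>, placed at \<open>a\<close>, so that branches can be glued there; confining all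
  paths to one branch of \<open>E\<close> keeps the glued pieces disjoint.\<close>

definition branch_emb :: "'k \<Rightarrow> 'k \<Rightarrow> 't \<Rightarrow> 't \<Rightarrow> ('k \<Rightarrow> 't) \<Rightarrow> ('k \<Rightarrow> 'k \<Rightarrow> 't list) \<Rightarrow> bool" where
  "branch_emb v w a b \<rho> P \<longleftrightarrow> top_emb E A (insert v (branch A v w)) \<rho> P \<and> \<rho> v = a \<and>
    \<rho> ` branch A v w \<subseteq> branch E a b \<and>
    (\<forall>x \<in> insert v (branch A v w). \<forall>y \<in> insert v (branch A v w). (x, y) \<in> A \<longrightarrow>
      set (P x y) \<subseteq> insert a (branch E a b))"

text \<open>Branches at \<open>w\<close> are pairwise disjoint, and so are the branches at
  \<open>b\<close> that receive them because \<open>g\<close> is injective. The pieces therefore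
  meet only in \<open>b\<close>, the image of \<open>w\<close>.\<close>

lemma glue_branches:
  assumes branches: "\<forall>u \<in> N. (w, u) \<in> A \<and> (b, g u) \<in> E \<and> (\<exists>\<rho> P. branch_emb w u b (g u) \<rho> P)"
    and g: "inj_on g N"
    and D: "D = insert w (\<Union>u \<in> N. branch A w u)" and B: "B = (\<Union>u \<in> N. branch E b (g u))"
  shows "\<exists>\<rho> P. top_emb E A D \<rho> P \<and> \<rho> w = b \<and> \<rho> ` (D - {w}) \<subseteq> B \<and>
    (\<forall>x \<in> D. \<forall>y \<in> D. (x, y) \<in> A \<longrightarrow> set (P x y) \<subseteq> insert b B \<and> (b \<in> set (P x y) \<longrightarrow> w \<in> {x, y}))"
proof -
  have N: "(w, u) \<in> A" "(b, g u) \<in> E" if "u \<in> N" for u using branches that by blast+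
  obtain R Q where RQ: "\<And>u. u \<in> N \<Longrightarrow> branch_emb w u b (g u) (R u) (Q u)"
    using branches by metis
  define Du where "Du = (\<lambda>u. insert w (branch A w u))"
  \<comment> \<open>\<open>k x\<close> is the branch at \<open>w\<close> that contains
    \<open>x\<close>, unique by disjointness. For an edge at \<open>w\<close>, the other end vertex
    selects the piece.\<close>
  define k where "k = (\<lambda>x. SOME u. u \<in> N \<and> x \<in> branch A w u)"
  define \<rho> where "\<rho> = (\<lambda>x. if x = w then b else R (k x) x)"
  define P where "P = (\<lambda>x y. Q (k (if x = w then y else x)) x y)"
  have te: "top_emb E A (Du u) (R u) (Q u)" and Rw: "R u w = b"
    and Rb: "R u ` branch A w u \<subseteq> branch E b (g u)"
    and Qb: "\<And>x y. x \<in> Du u \<Longrightarrow> y \<in> Du u \<Longrightarrow> (x, y) \<in> A \<Longrightarrow> set (Q u x y) \<subseteq> insert b (branch E b (g u))"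
    if "u \<in> N" for u
    using RQ[OF that] unfolding branch_emb_def Du_def by blast+
  have w: "w \<notin> branch A w u" if "u \<in> N" for u
    using K.branch_avoids[OF N(1)[OF that]] by blast
  have k: "k x = u" if "u \<in> N" "x \<in> branch A w u" for x u
  proof -
    have "k x \<in> N \<and> x \<in> branch A w (k x)" unfolding k_def by (rule someI[of _ u]) (use that in blast)
    then show ?thesis using K.branch_disjoint[OF N(1) N(1), of "k x" u] that by blast
  qed
  have \<rho>: "\<rho> x = R u x" if "u \<in> N" "x \<in> Du u" for x u
    using that k Rw w unfolding \<rho>_def Du_def by auto
  have P: "\<exists>u \<in> N. x \<in> Du u \<and> y \<in> Du u \<and> P x y = Q u x y \<and> P y x = Q u y x"
    if xy: "x \<in> D" "y \<in> D" "(x, y) \<in> A" for x y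
  proof -
    have ne: "x \<noteq> y" using K.no_loop[OF xy(3)] .
    consider "x = w" "y \<noteq> w" | "y = w" "x \<noteq> w" | "x \<noteq> w" "y \<noteq> w" using ne by blast
    then show ?thesis
    proof cases
      case 1
      then obtain u where "u \<in> N" "y \<in> branch A w u" using xy D by auto
      then show ?thesis using 1 k unfolding P_def Du_def by (intro bexI[of _ u]) auto
    next
      case 2
      then obtain u where "u \<in> N" "x \<in> branch A w u" using xy D by auto
      then show ?thesis using 2 k unfolding P_def Du_def by (intro bexI[of _ u]) auto
    next
      case 3
      then obtain u where u: "u \<in> N" "x \<in> branch A w u" using xy D by auto
      moreover have "y \<in> branch A w u" using branch_step[OF u(2) xy(3)] 3 by blast
      ultimately show ?thesis using 3 k unfolding P_def Du_def by (intro bexI[of _ u]) auto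
    qed
  qed
  \<comment> \<open>The path of the edge \<open>wu\<close> starts in \<open>b\<close>. Another path
    through \<open>b\<close> meets it there, so \<open>b\<close> is the image of a common end
    vertex, which is \<open>w\<close> by injectivity.\<close>
  have bw: "w \<in> {x, y}" if "u \<in> N" "x \<in> Du u" "y \<in> Du u" "(x, y) \<in> A" "b \<in> set (Q u x y)" for u x y
  proof (cases "{x, y} = {w, u}")
    case False
    have wu: "w \<in> Du u" "u \<in> Du u" "(w, u) \<in> A"
      using N(1)[OF that(1)] branch_root[of u] by (auto simp: Du_def)
    have "b \<in> set (Q u w u)"
      using top_embD(1)[OF te[OF that(1)] wu] Rw[OF that(1)] unfolding path_def by (metis hd_in_set)
    then have "b \<in> R u ` ({x, y} \<inter> {w, u})"
      using top_embD(3)[OF te[OF that(1)] that(2-4) wu False] that(5) by blast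
    then show ?thesis
      using te[OF that(1)] Rw[OF that(1)] that(2,3) wu unfolding top_emb_def inj_on_def by blast
  qed blast
  have Bdisj: "branch E b (g u) \<inter> branch E b (g u') = {}" if "u \<in> N" "u' \<in> N" "u \<noteq> u'" for u u'
    by (rule T.branch_disjoint[OF N(2) N(2)]) (use that g in \<open>auto dest: inj_onD\<close>)
  have bB: "b \<notin> branch E b (g u)" if "u \<in> N" for u
    using T.branch_avoids[OF N(2)[OF that]] by blast
  have Db: "\<exists>u \<in> N. x \<in> Du u \<and> x \<in> branch A w u \<and> \<rho> x \<in> branch E b (g u)" if "x \<in> D" "x \<noteq> w" for x
    using that D \<rho> Rb unfolding Du_def by (auto simp: image_subset_iff)
  have \<rho>w: "\<rho> w = b" by (simp add: \<rho>_def)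
  have inj: "inj_on \<rho> D"
  proof (rule inj_onI)
    fix x y assume xy: "x \<in> D" "y \<in> D" "\<rho> x = \<rho> y"
    show "x = y"
    proof (cases "x = w \<or> y = w")
      case True
      then show ?thesis using Db[OF xy(1)] Db[OF xy(2)] xy \<rho>w bB by metis
    next
      case False
      then obtain u u' where u: "u \<in> N" "x \<in> Du u" "\<rho> x \<in> branch E b (g u)"
        and u': "u' \<in> N" "y \<in> Du u'" "\<rho> y \<in> branch E b (g u')"
        using Db xy by metis
      then have "u = u'" using Bdisj xy(3) by fastforce
      then show ?thesis
        using u u' \<rho> xy(3) te[OF u(1)] unfolding top_emb_def inj_on_def by metis
    qed
  qed
  have paths: "path E (\<rho> x) (P x y) (\<rho> y) \<and> P y x = rev (P x y)" if xy: "x \<in> D" "y \<in> D" "(x, y) \<in> A" for x y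
  proof -
    obtain u where "u \<in> N" "x \<in> Du u" "y \<in> Du u" "P x y = Q u x y" "P y x = Q u y x"
      using P[OF xy] by blast
    then show ?thesis using top_embD(1,2)[OF te _ _ xy(3)] \<rho> by metis
  qed
  have disj: "set (P x y) \<inter> set (P x' y') \<subseteq> \<rho> ` ({x, y} \<inter> {x', y'})"
    if xy: "x \<in> D" "y \<in> D" "(x, y) \<in> A" and xy': "x' \<in> D" "y' \<in> D" "(x', y') \<in> A"
      and ne: "{x, y} \<noteq> {x', y'}" for x y x' y'
  proof -
    obtain u where u: "u \<in> N" "x \<in> Du u" "y \<in> Du u" "P x y = Q u x y" using P[OF xy] by blast
    obtain u' where u': "u' \<in> N" "x' \<in> Du u'" "y' \<in> Du u'" "P x' y' = Q u' x' y'" using P[OF xy'] by blast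
    show ?thesis
    proof (cases "u = u'")
      case True
      have "\<rho> ` ({x, y} \<inter> {x', y'}) = R u ` ({x, y} \<inter> {x', y'})"
        using \<rho>[OF u(1)] u(2,3) by (intro image_cong) auto
      then show ?thesis
        using True top_embD(3)[OF te[OF u(1)] u(2,3) xy(3) _ _ xy'(3) ne] u u' by auto
    next
      case False
      have "set (P x y) \<inter> set (P x' y') \<subseteq> {b}"
        using Qb[OF u(1-3) xy(3)] Qb[OF u'(1-3) xy'(3)] Bdisj[OF u(1) u'(1) False] u(4) u'(4) by auto
      moreover have "b \<in> \<rho> ` ({x, y} \<inter> {x', y'})" if "b \<in> set (P x y)" "b \<in> set (P x' y')"
        using bw[OF u(1-3) xy(3)] bw[OF u'(1-3) xy'(3)] that u(4) u'(4) \<rho>w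
        by (intro image_eqI[of _ _ w]) auto
      ultimately show ?thesis by blast
    qed
  qed
  have "top_emb E A D \<rho> P" using inj paths disj unfolding top_emb_def by blast
  moreover have "\<rho> ` (D - {w}) \<subseteq> B" using Db unfolding B by blast
  moreover have "set (P x y) \<subseteq> insert b B \<and> (b \<in> set (P x y) \<longrightarrow> w \<in> {x, y})"
    if xy: "x \<in> D" "y \<in> D" "(x, y) \<in> A" for x y
  proof -
    obtain u where u: "u \<in> N" "x \<in> Du u" "y \<in> Du u" "P x y = Q u x y" using P[OF xy] by blast
    then show ?thesis using Qb[OF u(1-3) xy(3)] bw[OF u(1-3) xy(3)] unfolding B by auto
  qed
  ultimately show ?thesis using \<rho>w by (intro exI[of _ \<rho>] exI[of _ P] conjI ballI impI) auto
qed

text \<open>Induction on the embedding: \<open>extend\<close> moves the entry vertex one arc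
  outwards, while \<open>node\<close> glues the branches at \<open>w\<close> and then attaches the
  entry vertex.\<close>

lemma emb_branch_emb:
  assumes "emb A E v w a b"
  shows "\<exists>\<rho> P. branch_emb v w a b \<rho> P"
  using assms
proof (induction rule: emb.induct)
  case (extend a b c v w)
  then obtain \<rho> P where "branch_emb v w b c \<rho> P" by blast
  then have emb: "top_emb E A (insert v (branch A v w)) \<rho> P" and \<rho>v: "\<rho> v = b"
    and \<rho>: "\<rho> ` branch A v w \<subseteq> branch E b c"
    and P: "\<And>x y. x \<in> insert v (branch A v w) \<Longrightarrow> y \<in> insert v (branch A v w) \<Longrightarrow> (x, y) \<in> A \<Longrightarrow>
      set (P x y) \<subseteq> insert b (branch E b c)"
    unfolding branch_emb_def by blast+
  have vw: "(v, w) \<in> A" using extend.hyps(4) emb_arcs by metis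
  have sub: "insert b (branch E b c) \<subseteq> branch E a b"
    using T.branch_subset[OF extend.hyps(1-3)] branch_root[of b E a] by blast
  have a: "a \<notin> branch E a b" using T.branch_avoids[OF extend.hyps(1)] by blast
  have w: "w \<in> branch A v w" by (rule branch_root)
  have v: "v \<notin> branch A v w" using K.branch_avoids[OF vw] by blast
  \<comment> \<open>The image of \<open>v\<close> moves from \<open>b\<close> to \<open>a\<close>,
    so \<open>b\<close> becomes an inner vertex of the path of \<open>vw\<close>.\<close>
  define Q where "Q = a # P v w"
  define P' where "P' = (\<lambda>x y. if x = v then Q else if y = v then rev Q else P x y)"
  have pvw: "path E b (P v w) (\<rho> w)" using top_embD(1)[OF emb _ _ vw] w \<rho>v by auto
  have setQ: "set (P v w) \<subseteq> branch E a b" using P[OF _ _ vw] w sub by auto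
  have Q: "path E a Q (\<rho> w)"
    using pvw setQ a extend.hyps(1) unfolding path_def Q_def by (auto simp: successively_Cons)
  have "top_emb E A (insert v (branch A v w)) (\<rho>(v := a)) P'"
  proof (rule top_emb_attach[OF top_emb_subset[OF emb] v w K.symm _ T.symm _ Q])
    show "x = w" if "x \<in> insert v (branch A v w)" "(v, x) \<in> A" for x
      using that K.acyclic[OF vw, of x] K.no_loop by blast
    show "a \<notin> \<rho> ` branch A v w" using \<rho> sub a by blast
    show "set Q \<inter> set (P x y) \<subseteq> \<rho> ` ({w} \<inter> {x, y})"
      if xy: "x \<in> branch A v w" "y \<in> branch A v w" "(x, y) \<in> A" for x y
    proof -
      have "{v, w} \<noteq> {x, y}" "{v, w} \<inter> {x, y} = {w} \<inter> {x, y}" using xy v by auto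
      then have "set (P v w) \<inter> set (P x y) \<subseteq> \<rho> ` ({w} \<inter> {x, y})"
        using top_embD(3)[OF emb _ _ vw, of x y] xy w by auto
      moreover have "a \<notin> set (P x y)" using P[of x y] xy sub a by blast
      ultimately show ?thesis unfolding Q_def by auto
    qed
  qed (auto simp: P'_def)
  moreover have "(\<rho>(v := a)) ` branch A v w \<subseteq> branch E a b"
    using \<rho> sub v by (auto simp: image_subset_iff)
  moreover have "set (P' x y) \<subseteq> insert a (branch E a b)"
    if "x \<in> insert v (branch A v w)" "y \<in> insert v (branch A v w)" "(x, y) \<in> A" for x y
    using P[OF that] setQ sub unfolding P'_def Q_def by auto
  ultimately show ?case unfolding branch_emb_def by (intro exI[of _ "\<rho>(v := a)"] exI[of _ P']) auto
next
  case (node a b v w g)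
  define N where "N = {u. (w, u) \<in> A \<and> u \<noteq> v}"
  note vw = node.hyps(2)
  have D: "branch A v w = insert w (\<Union>u \<in> N. branch A w u)"
    using K.branch_decomp[OF vw] unfolding N_def .
  have N: "(w, u) \<in> A" "(b, g u) \<in> E" "g u \<noteq> a" "\<exists>\<rho> P. branch_emb w u b (g u) \<rho> P" if "u \<in> N" for u
    using node.IH[of u] that unfolding N_def by blast+
  have "inj_on g N" using node.hyps(3) unfolding N_def .
  moreover have "\<forall>u \<in> N. (w, u) \<in> A \<and> (b, g u) \<in> E \<and> (\<exists>\<rho> P. branch_emb w u b (g u) \<rho> P)"
    using N by blast
  from glue_branches[OF this \<open>inj_on g N\<close> D refl]
  obtain \<rho> P where emb: "top_emb E A (branch A v w) \<rho> P" and \<rho>w: "\<rho> w = b"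
    and \<rho>: "\<rho> ` (branch A v w - {w}) \<subseteq> (\<Union>u \<in> N. branch E b (g u))"
    and P: "\<And>x y. x \<in> branch A v w \<Longrightarrow> y \<in> branch A v w \<Longrightarrow> (x, y) \<in> A \<Longrightarrow>
      set (P x y) \<subseteq> insert b (\<Union>u \<in> N. branch E b (g u)) \<and> (b \<in> set (P x y) \<longrightarrow> w \<in> {x, y})"
    by (elim exE conjE) blast
  have sub: "insert b (\<Union>u \<in> N. branch E b (g u)) \<subseteq> branch E a b"
    using T.branch_subset[OF node.hyps(1) N(2,3)] branch_root[of b E a] by blast
  have a: "a \<notin> branch E a b" using T.branch_avoids[OF node.hyps(1)] by blast
  have w: "w \<in> branch A v w" by (rule branch_root)
  have v: "v \<notin> branch A v w" using K.branch_avoids[OF vw] by blast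
  define Q where "Q = [a, b]"
  define P' where "P' = (\<lambda>x y. if x = v then Q else if y = v then rev Q else P x y)"
  have Q: "path E a Q (\<rho> w)"
    using \<rho>w node.hyps(1) T.no_loop unfolding path_def Q_def by auto
  have \<rho>': "\<rho> ` branch A v w \<subseteq> branch E a b" using \<rho> \<rho>w sub by blast
  have "top_emb E A (insert v (branch A v w)) (\<rho>(v := a)) P'"
  proof (rule top_emb_attach[OF emb v w K.symm _ T.symm _ Q])
    show "x = w" if "x \<in> insert v (branch A v w)" "(v, x) \<in> A" for x
      using that K.acyclic[OF vw, of x] K.no_loop by blast
    show "a \<notin> \<rho> ` branch A v w" using \<rho>' a by blast
    show "set Q \<inter> set (P x y) \<subseteq> \<rho> ` ({w} \<inter> {x, y})"
      if xy: "x \<in> branch A v w" "y \<in> branch A v w" "(x, y) \<in> A" for x y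
      using P[OF xy] sub a \<rho>w unfolding Q_def by auto
  qed (auto simp: P'_def)
  moreover have "(\<rho>(v := a)) ` branch A v w \<subseteq> branch E a b"
    using \<rho>' v by (auto simp: image_subset_iff)
  moreover have "set (P' x y) \<subseteq> insert a (branch E a b)"
    if "x \<in> insert v (branch A v w)" "y \<in> insert v (branch A v w)" "(x, y) \<in> A" for x y
    using P[of x y] that sub unfolding P'_def Q_def by auto
  ultimately show ?case unfolding branch_emb_def by (intro exI[of _ "\<rho>(v := a)"] exI[of _ P']) auto
qed

lemma full_emb_top_emb:
  assumes "full_emb A E w b"
  shows "\<exists>\<rho> P. top_emb E A (insert w (\<Union>u \<in> {u. (w, u) \<in> A}. branch A w u)) \<rho> P \<and>
    \<rho> w = b \<and> \<rho> ` (\<Union>u \<in> {u. (w, u) \<in> A}. branch A w u) \<subseteq> snd ` E"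
proof -
  obtain g where g: "inj_on g {u. (w, u) \<in> A}"
    "\<And>u. (w, u) \<in> A \<Longrightarrow> (b, g u) \<in> E \<and> emb A E w u b (g u)"
    using assms unfolding full_emb_def by blast
  define N where "N = {u. (w, u) \<in> A}"
  have N: "(w, u) \<in> A" "(b, g u) \<in> E" "\<exists>\<rho> P. branch_emb w u b (g u) \<rho> P" if "u \<in> N" for u
    using that g emb_branch_emb unfolding N_def by blast+
  have "y \<in> snd ` E" if "u \<in> N" "y \<in> branch E b (g u)" for u y
    using that(2) N(2)[OF that(1)] by (induction rule: branch_induct) force+
  then have "(\<Union>u \<in> N. branch E b (g u)) \<subseteq> snd ` E" by blast
  moreover have "w \<notin> (\<Union>u \<in> N. branch A w u)" using K.branch_avoids N(1) by blast
  moreover have "inj_on g N" using g(1) unfolding N_def .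
  moreover have "\<forall>u \<in> N. (w, u) \<in> A \<and> (b, g u) \<in> E \<and> (\<exists>\<rho> P. branch_emb w u b (g u) \<rho> P)"
    using N by blast
  from glue_branches[OF this \<open>inj_on g N\<close> refl refl]
  obtain \<rho> P where "top_emb E A (insert w (\<Union>u \<in> N. branch A w u)) \<rho> P" "\<rho> w = b"
    "\<rho> ` (insert w (\<Union>u \<in> N. branch A w u) - {w}) \<subseteq> (\<Union>u \<in> N. branch E b (g u))"
    by (elim exE conjE)
  ultimately show ?thesis
    unfolding N_def[symmetric] by (intro exI[of _ \<rho>] exI[of _ P]) auto
qed

end

section \<open>Parity systems on forests\<close>

lemma odd_card_disagree:
  assumes "finite S"
  shows "odd (card {u \<in> S. g u \<noteq> f u}) \<longleftrightarrow> odd (card {u \<in> S. g u}) \<noteq> odd (card {u \<in> S. f u})"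
  using assms
proof (induction rule: finite_induct)
  case (insert x S)
  have "{u \<in> insert x S. P u} = (if P x then insert x {u \<in> S. P u} else {u \<in> S. P u})" for P
    by auto
  with insert show ?case by auto
qed simp

lemma odd_card_remove:
  assumes "finite S" "v \<in> S"
  shows "odd (card {u \<in> S. g u}) \<longleftrightarrow> odd (card {u \<in> S. u \<noteq> v \<and> g u}) \<noteq> g v"
proof -
  have "{u \<in> S. g u} = (if g v then insert v {u \<in> S. u \<noteq> v \<and> g u} else {u \<in> S. u \<noteq> v \<and> g u})"
    using assms(2) by auto
  then show ?thesis using assms(1) by auto
qed

text \<open>\<open>R\<close> is a partial prescription of membership. An element without
  prescription can be switched to correct the parity; if every element is prescribed,
  \<open>total\<close> says that the parity is already right.\<close>

lemma parity_completion:
  assumes "finite N" and uniq: "\<And>u t t'. u \<in> N \<Longrightarrow> R u t \<Longrightarrow> R u t' \<Longrightarrow> t = t'"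
    and total: "\<And>g. (\<forall>u \<in> N. R u (g u)) \<Longrightarrow> odd (card {u \<in> N. g u}) = p"
  shows "\<exists>X \<subseteq> N. odd (card X) = p \<and> (\<forall>u \<in> N. \<forall>t. R u t \<longrightarrow> (u \<in> X) = t)"
proof -
  define g where "g = (\<lambda>u. R u True)"
  have g: "R u t \<Longrightarrow> g u = t" if "u \<in> N" for u t
    using uniq[OF that, of t True] by (auto simp: g_def)
  show ?thesis
  proof (cases "odd (card {u \<in> N. g u}) = p")
    case True
    then show ?thesis using g by (intro exI[of _ "{u \<in> N. g u}"]) auto
  next
    case False
    then obtain v where v: "v \<in> N" "\<not> R v (g v)" using total by blast
    then have nv: "\<not> R v t" for t using g by blast
    define h where "h = g(v := \<not> g v)"
    have "{u \<in> N. u \<noteq> v \<and> h u} = {u \<in> N. u \<noteq> v \<and> g u}" by (auto simp: h_def)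
    then have "odd (card {u \<in> N. h u}) = p"
      using False odd_card_remove[OF assms(1) v(1), of g] odd_card_remove[OF assms(1) v(1), of h]
      by (auto simp: h_def)
    moreover have "(u \<in> {u \<in> N. h u}) = t" if "u \<in> N" "R u t" for u t
      using that g nv by (auto simp: h_def)
    ultimately show ?thesis by (intro exI[of _ "{u \<in> N. h u}"]) auto
  qed
qed

text \<open>\<open>W\<close> is the vertex set of the component \<open>K\<close> with edges
  \<open>A\<close>, and \<open>V\<close> and \<open>E\<close> are the part of the forest lying over
  it. \<open>towards\<close> expresses connectedness of \<open>K\<close>, and
  \<open>not_full\<close> says that no subdivision of \<open>K\<close> is found around any vertex of
  \<open>V\<close>.\<close>

locale tree_target = forest_pair E A for E :: "'t rel" and A :: "'k rel" +
  fixes \<phi> :: "'t \<Rightarrow> 'k" and s :: 'k and W :: "'k set" and V :: "'t set"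
  assumes hom: "(a, b) \<in> E \<Longrightarrow> (\<phi> a, \<phi> b) \<in> A"
    and towards: "w \<in> W \<Longrightarrow> w \<noteq> s \<Longrightarrow> \<exists>u. (w, u) \<in> A \<and> s \<in> branch A w u"
    and A_W: "(v, w) \<in> A \<Longrightarrow> v \<in> W"
    and E_V: "(a, b) \<in> E \<Longrightarrow> a \<in> V"
    and V_W: "a \<in> V \<Longrightarrow> \<phi> a \<in> W"
    and fin_V: "finite V"
    and not_full: "w \<in> W \<Longrightarrow> b \<in> V \<Longrightarrow> \<not> full_emb A E w b"
begin

abbreviation N :: "'k \<Rightarrow> 'k set" where
  "N w \<equiv> {u. (w, u) \<in> A}"

text \<open>Summing the vertex equations of \<open>K\<close> over the branch beyond
  \<open>(v, w)\<close> cancels every edge except \<open>vw\<close>, so \<open>f v w\<close> is the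
  only value a solution on that branch can give to \<open>vw\<close>.\<close>

abbreviation f :: "'k \<Rightarrow> 'k \<Rightarrow> bool" where
  "f v w \<equiv> s \<in> branch A v w"

lemma finite_N: "finite (N w)"
proof -
  have "N w \<subseteq> snd ` A" by force
  then show ?thesis using K.fin finite_subset by blast
qed

lemma f_opposite:
  assumes "(v, w) \<in> A"
  shows "f v w \<longleftrightarrow> \<not> f w v"
proof
  show "f v w \<Longrightarrow> \<not> f w v" using K.branch_opposite_disjoint[OF assms] by blast
  show "f v w" if "\<not> f w v"
  proof (cases "w = s")
    case True
    then show ?thesis by (simp add: branch_root)
  next
    case False
    then obtain u where u: "(w, u) \<in> A" "f w u"
      using towards A_W K.symm[OF assms] by blast
    then have "u \<noteq> v" using that by blast
    then show ?thesis using K.branch_subset[OF assms u(1)] u(2) by blast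
  qed
qed

text \<open>Exactly one branch at \<open>w\<close> contains \<open>s\<close>, or none if
  \<open>w = s\<close>. The outward values \<open>f w u\<close> thus violate the vertex equation at
  every \<open>w\<close>: a copy of all branches of \<open>K\<close> around one vertex is precisely
  an obstruction.\<close>

lemma odd_card_f:
  assumes "w \<in> W"
  shows "odd (card {u \<in> N w. f w u}) \<longleftrightarrow> w \<noteq> s"
proof (cases "w = s")
  case True
  then have e: "{u \<in> N w. f w u} = {}" using K.branch_avoids by blast
  show ?thesis unfolding e using True by simp
next
  case False
  then obtain u where u: "(w, u) \<in> A" "f w u" using towards assms by blast
  then have e: "{u \<in> N w. f w u} = {u}" using K.branch_disjoint[of w u] by blast
  show ?thesis unfolding e using False by simp
qed

lemma no_emb_both_sides:
  assumes "emb A E u w b c" "emb A E w u b d"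
  shows "c = d"
  using emb_both_sides[OF assms] not_full A_W E_V by force

text \<open>The branch beyond \<open>(v, w)\<close> contains the one beyond \<open>(w, u)\<close>,
  which is opposite to \<open>(u, w)\<close>. If \<open>c\<close> and \<open>d\<close> differed,
  both sides of the edge \<open>uw\<close> would embed in different branches at
  \<open>b\<close>.\<close>

lemma no_two_backward:
  assumes "emb A E u w b c" "emb A E v w b d" "u \<noteq> v"
  shows "c = d"
proof -
  have "(w, u) \<in> A" using emb_arcs[OF assms(1)] K.symm by blast
  then show ?thesis
    using no_emb_both_sides[OF assms(1) emb_sub_branch[OF assms(2)]] assms(3) by blast
qed

text \<open>
  \<open>forced a b t\<close>: every solution of the parity system on the branch entered through \<open>(a, b)\<close>
  assigns the value \<open>t\<close> to the edge \<open>ab\<close>.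
\<close>

inductive forced :: "'t \<Rightarrow> 't \<Rightarrow> bool \<Rightarrow> bool" where
  pass: "(a, b) \<in> E \<Longrightarrow> (b, c) \<in> E \<Longrightarrow> c \<noteq> a \<Longrightarrow> \<phi> c = \<phi> a \<Longrightarrow> forced b c t \<Longrightarrow> forced a b t"
| sum: "(a, b) \<in> E \<Longrightarrow>
    (\<And>u. (\<phi> b, u) \<in> A \<Longrightarrow> u \<noteq> \<phi> a \<Longrightarrow> \<exists>c. (b, c) \<in> E \<and> \<phi> c = u \<and> forced b c (g u)) \<Longrightarrow>
    t = (odd (card {u \<in> N (\<phi> b). u \<noteq> \<phi> a \<and> g u}) \<noteq> (\<phi> b = s)) \<Longrightarrow> forced a b t"

text \<open>
  Since exactly one of the two branches of \<open>A\<close> at the edge \<open>\<phi>(a)\<phi>(b)\<close> contains \<open>s\<close>, the forced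
  value tells which of them is topologically contained in the branch of \<open>E\<close> entered through
  \<open>(a, b)\<close>.
\<close>

abbreviation witness :: "'t \<Rightarrow> 't \<Rightarrow> bool \<Rightarrow> bool" where
  "witness a b t \<equiv>
    (if t = f (\<phi> a) (\<phi> b) then emb A E (\<phi> a) (\<phi> b) a b else emb A E (\<phi> b) (\<phi> a) a b)"

text \<open>Each disagreement with \<open>f\<close> embeds a backward branch, and two of them behind
  different neighbours of \<open>b\<close> are impossible.\<close>

lemma disagree_unique:
  assumes "\<And>u. u \<in> S \<Longrightarrow> \<phi> (c u) = u \<and> witness b (c u) (g u)"
    and "u \<in> S" "g u \<noteq> f (\<phi> b) u" "v \<in> S" "g v \<noteq> f (\<phi> b) v"
  shows "u = v"
proof (rule ccontr)
  assume "u \<noteq> v"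
  moreover have "emb A E u (\<phi> b) b (c u)" "emb A E v (\<phi> b) b (c v)"
    using assms(1)[OF assms(2)] assms(1)[OF assms(4)] assms(3,5) by auto
  ultimately have "c u = c v" using no_two_backward by blast
  then show False using assms(1)[OF assms(2)] assms(1)[OF assms(4)] \<open>u \<noteq> v\<close> by metis
qed

text \<open>In the \<open>sum\<close> case at most one forced value disagrees with \<open>f\<close>.
  If none does, the embedded branches assemble into the forward branch; if one does, its backward
  embedding contains the backward branch at the entering edge. In the \<open>pass\<close> case the
  edge is traversed in reverse, which flips \<open>f\<close> and exchanges the two sides.\<close>

lemma forced_witness: "forced a b t \<Longrightarrow> witness a b t"
proof (induction rule: forced.induct)
  case (pass a b c t)
  have ab: "(\<phi> a, \<phi> b) \<in> A" using hom[OF pass.hyps(1)] .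
  show ?case
    using pass.IH pass.hyps(4) f_opposite[OF ab]
    by (auto split: if_splits intro: emb.extend[OF pass.hyps(1-3)])
next
  case (sum a b g t)
  define v w where "v = \<phi> a" and "w = \<phi> b"
  define S where "S = {u \<in> N w. u \<noteq> v}"
  obtain c where c: "\<And>u. u \<in> S \<Longrightarrow> (b, c u) \<in> E \<and> \<phi> (c u) = u \<and> witness b (c u) (g u)"
    using sum.IH unfolding S_def v_def w_def by (auto) metis
  have vw: "(v, w) \<in> A" using hom[OF sum.hyps(1)] by (simp add: v_def w_def)
  have S: "finite S" "{u \<in> N w. u \<noteq> v \<and> h u} = {u \<in> S. h u}" for h
    using finite_N by (auto simp: S_def)
  have "odd (card {u \<in> N w. f w u}) \<longleftrightarrow> w \<noteq> s" using odd_card_f A_W K.symm[OF vw] by blast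
  then have "odd (card {u \<in> S. f w u}) \<noteq> f w v \<longleftrightarrow> w \<noteq> s"
    using odd_card_remove[OF finite_N[of w], of v "f w", unfolded S(2)] K.symm[OF vw] by blast
  moreover have "t = (odd (card {u \<in> S. g u}) \<noteq> (w = s))"
    using sum.hyps(2) unfolding v_def[symmetric] w_def[symmetric] S(2) .
  \<comment> \<open>\<open>f\<close> satisfies the recursion that defines \<open>t\<close>, so the
    terms \<open>w = s\<close> cancel and only the disagreements of \<open>g\<close> with
    \<open>f\<close> remain.\<close>
  ultimately have t: "t \<noteq> f v w \<longleftrightarrow> odd (card {u \<in> S. g u \<noteq> f w u})"
    using odd_card_disagree[OF S(1), of g "f w"] f_opposite[OF vw] by blast
  show ?case
  proof (cases "\<forall>u \<in> S. g u = f w u")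
    case True
    then have e: "{u \<in> S. g u \<noteq> f w u} = {}" by blast
    have "t = f v w" using t[unfolded e] by simp
    moreover have "emb A E v w a b"
    proof (rule emb.node[OF sum.hyps(1) vw])
      show "inj_on c {u. (w, u) \<in> A \<and> u \<noteq> v}"
        using c unfolding S_def by (intro inj_onI) (auto, metis)
      show "(b, c u) \<in> E \<and> c u \<noteq> a \<and> emb A E w u b (c u)" if "(w, u) \<in> A" "u \<noteq> v" for u
        using c[of u] True that unfolding S_def v_def w_def by auto
    qed
    ultimately show ?thesis by (simp add: v_def w_def)
  next
    case False
    then obtain u where u: "u \<in> S" "g u \<noteq> f w u" by blast
    then have e: "{u \<in> S. g u \<noteq> f w u} = {u}"
      using disagree_unique[where S = S and c = c and b = b and g = g] c unfolding w_def by blast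
    have "t \<noteq> f v w" using t[unfolded e] by simp
    moreover have "emb A E u w b (c u)" using c[OF u(1)] u(2) unfolding w_def by auto
    then have "emb A E w v b (c u)"
      by (rule emb_sub_branch[OF _ K.symm[OF vw]]) (use u(1) in \<open>auto simp: S_def\<close>)
    then have "emb A E w v a b"
      by (rule emb.extend[OF sum.hyps(1), rotated 2]) (use c[OF u(1)] u(1) in \<open>auto simp: S_def v_def\<close>)
    ultimately show ?thesis by (simp add: v_def w_def)
  qed
qed

text \<open>If all forced values agreed with \<open>f\<close>, a full copy of \<open>K\<close> would
  appear around \<open>b\<close>. So exactly one disagrees, and this single change corrects the
  wrong parity of \<open>f\<close>.\<close>

lemma vertex_parity:
  assumes b: "b \<in> V"
    and g: "\<And>u. u \<in> N (\<phi> b) \<Longrightarrow> \<exists>c. (b, c) \<in> E \<and> \<phi> c = u \<and> forced b c (g u)"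
  shows "odd (card {u \<in> N (\<phi> b). g u}) \<longleftrightarrow> \<phi> b = s"
proof -
  define w where "w = \<phi> b"
  have w: "w \<in> W" using V_W b by (simp add: w_def)
  obtain c where c: "\<And>u. u \<in> N w \<Longrightarrow> (b, c u) \<in> E \<and> \<phi> (c u) = u \<and> witness b (c u) (g u)"
    using g forced_witness unfolding w_def by metis
  show ?thesis
  proof (cases "\<forall>u \<in> N w. g u = f w u")
    case True
    have "inj_on c (N w)" using c by (intro inj_onI) metis
    moreover have "(b, c u) \<in> E \<and> emb A E w u b (c u)" if "(w, u) \<in> A" for u
      using c[of u] True that unfolding w_def by auto
    ultimately have "full_emb A E w b" unfolding full_emb_def by blast
    then show ?thesis using not_full b w by blast
  next
    case False
    then obtain u where u: "u \<in> N w" "g u \<noteq> f w u" by blast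
    then have e: "{u \<in> N w. g u \<noteq> f w u} = {u}"
      using disagree_unique[where S = "N w" and c = c and b = b and g = g] c unfolding w_def by blast
    have "odd (card {u \<in> N w. g u \<noteq> f w u})" unfolding e by simp
    then show ?thesis
      using odd_card_disagree[OF finite_N[of w], of g "f w"] odd_card_f[OF w] unfolding w_def by blast
  qed
qed

text \<open>Different values would embed the two sides of one edge of \<open>K\<close> in different
  branches at \<open>b\<close>.\<close>

lemma forced_unique_siblings:
  assumes "forced b c t" "forced b d t'" "\<phi> c = \<phi> d" "c \<noteq> d"
  shows "t = t'"
  using forced_witness[OF assms(1)] forced_witness[OF assms(2)] assms(3,4)
    no_emb_both_sides[of "\<phi> b" "\<phi> c" b c d] no_emb_both_sides[of "\<phi> c" "\<phi> b" b c d]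
  by (auto split: if_splits)

lemma forced_pass_sum:
  assumes ab: "(a, b) \<in> E" and c: "(b, c) \<in> E" "\<phi> c = \<phi> a" "forced b c t"
    and g: "\<And>u. (\<phi> b, u) \<in> A \<Longrightarrow> u \<noteq> \<phi> a \<Longrightarrow> \<exists>c. (b, c) \<in> E \<and> \<phi> c = u \<and> forced b c (g u)"
  shows "t = (odd (card {u \<in> N (\<phi> b). u \<noteq> \<phi> a \<and> g u}) \<noteq> (\<phi> b = s))"
proof -
  define h where "h = g(\<phi> a := t)"
  have "\<exists>c. (b, c) \<in> E \<and> \<phi> c = u \<and> forced b c (h u)" if "u \<in> N (\<phi> b)" for u
    using that g[of u] c by (cases "u = \<phi> a") (auto simp: h_def)
  then have "odd (card {u \<in> N (\<phi> b). h u}) \<longleftrightarrow> \<phi> b = s"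
    using vertex_parity E_V[OF c(1)] by blast
  moreover have "\<phi> a \<in> N (\<phi> b)" using hom[OF T.symm[OF ab]] by simp
  moreover have "{u \<in> N (\<phi> b). u \<noteq> \<phi> a \<and> h u} = {u \<in> N (\<phi> b). u \<noteq> \<phi> a \<and> g u}"
    by (auto simp: h_def)
  ultimately show ?thesis
    using odd_card_remove[OF finite_N, of "\<phi> a" "\<phi> b" h] by (auto simp: h_def)
qed

text \<open>The last rules of two derivations are compared: two uses of \<open>pass\<close> agree by
  induction or as siblings, \<open>pass\<close> against \<open>sum\<close> agrees by the vertex
  equation at \<open>b\<close>, and two uses of \<open>sum\<close> have equal summands.\<close>

lemma forced_unique: "forced a b t \<Longrightarrow> forced a b t' \<Longrightarrow> t = t'"
proof (induction arbitrary: t' rule: forced.induct)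
  case (pass a b c t)
  from pass.prems show ?case
  proof (cases rule: forced.cases)
    case (pass d)
    show ?thesis
    proof (cases "c = d")
      case True
      then show ?thesis using pass.IH pass(5) by blast
    next
      case False
      then show ?thesis
        using forced_unique_siblings[OF pass.hyps(5) pass(5)] pass.hyps(4) pass(4) by simp
    qed
  next
    case (sum g)
    show ?thesis
      using forced_pass_sum[OF pass.hyps(1,2,4,5) sum(2)] sum(3) by blast
  qed
next
  case (sum a b g t)
  have g: "\<exists>c. (b, c) \<in> E \<and> \<phi> c = u \<and> forced b c (g u)" if "(\<phi> b, u) \<in> A" "u \<noteq> \<phi> a" for u
    using sum.IH[OF that] by blast
  from sum.prems show ?case
  proof (cases rule: forced.cases)
    case (pass c)
    then show ?thesis using forced_pass_sum[OF pass(1,2,4,5) g] sum.hyps(2) by blast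
  next
    case (sum h)
    have "g u = h u" if u: "(\<phi> b, u) \<in> A" "u \<noteq> \<phi> a" for u
    proof -
      obtain c where c: "\<phi> c = u" "forced b c (g u)" "\<And>t'. forced b c t' \<Longrightarrow> g u = t'"
        using sum.IH[OF u] by blast
      obtain d where d: "\<phi> d = u" "forced b d (h u)" using sum(2)[OF u] by blast
      show ?thesis
      proof (cases "c = d")
        case True
        then show ?thesis using c(3) d(2) by blast
      next
        case False
        then show ?thesis using forced_unique_siblings[OF c(2) d(2)] c(1) d(1) by simp
      qed
    qed
    then have "{u \<in> N (\<phi> b). u \<noteq> \<phi> a \<and> g u} = {u \<in> N (\<phi> b). u \<noteq> \<phi> a \<and> h u}" by blast
    then show ?thesis using sum(3) sum.hyps(2) by simp
  qed
qed

lemma forced_unique_kind: "forced b c t \<Longrightarrow> forced b d t' \<Longrightarrow> \<phi> c = \<phi> d \<Longrightarrow> t = t'"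
  using forced_unique forced_unique_siblings by metis

text \<open>Greedy solution with the invariant that the value chosen on an arc equals every value
  forced from beyond it. Since \<open>X b\<close> consists of neighbours of \<open>\<phi> b\<close>,
  edges at \<open>b\<close> with the same image share one value.\<close>

lemma parity_system_solvable:
  "\<exists>X. (\<forall>b \<in> V. X b \<subseteq> N (\<phi> b) \<and> (odd (card (X b)) \<longleftrightarrow> \<phi> b = s)) \<and>
    (\<forall>a \<in> V. \<forall>b \<in> V. (a, b) \<in> E \<longrightarrow> (\<phi> b \<in> X a \<longleftrightarrow> \<phi> a \<in> X b))"
proof (rule T.propagate[OF fin_V,
      where I = "\<lambda>b X c. \<forall>t. forced b c t \<longrightarrow> (\<phi> c \<in> X) = t"])
  fix b assume b: "b \<in> V"
  have "\<exists>X \<subseteq> N (\<phi> b). odd (card X) = (\<phi> b = s) \<and>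
      (\<forall>u \<in> N (\<phi> b). \<forall>t. (\<exists>c. (b, c) \<in> E \<and> \<phi> c = u \<and> forced b c t) \<longrightarrow> (u \<in> X) = t)"
    by (rule parity_completion[OF finite_N]) (use forced_unique_kind vertex_parity[OF b] in blast)+
  then obtain X where X: "X \<subseteq> N (\<phi> b)" "odd (card X) = (\<phi> b = s)"
    "\<And>u t c. u \<in> N (\<phi> b) \<Longrightarrow> (b, c) \<in> E \<Longrightarrow> \<phi> c = u \<Longrightarrow> forced b c t \<Longrightarrow> (u \<in> X) = t" by blast
  have "(\<phi> c \<in> X) = t" if "(b, c) \<in> E" "forced b c t" for c t
    using X(3)[OF _ that(1) refl that(2)] hom[OF that(1)] by blast
  then show "\<exists>X. (X \<subseteq> N (\<phi> b) \<and> odd (card X) = (\<phi> b = s)) \<and>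
      (\<forall>c. (b, c) \<in> E \<longrightarrow> (\<forall>t. forced b c t \<longrightarrow> (\<phi> c \<in> X) = t))"
    using X(1,2) by blast
next
  fix a b Y
  assume ab: "(a, b) \<in> E" and Y: "\<forall>t. forced a b t \<longrightarrow> (\<phi> b \<in> Y) = t"
  define v \<tau> where "v = \<phi> a" and "\<tau> = (\<phi> b \<in> Y)"
  \<comment> \<open>The inherited value \<open>\<tau>\<close> is prescribed at \<open>v\<close>, and
    forced values elsewhere. If this prescribes everything, rule \<open>sum\<close> forces the
    entering edge, so \<open>\<tau>\<close> already has the value that the parity requires.\<close>
  define R where "R = (\<lambda>u t. if u = v then t = \<tau> else \<exists>c. (b, c) \<in> E \<and> \<phi> c = u \<and> forced b c t)"
  have v: "v \<in> N (\<phi> b)" using hom[OF T.symm[OF ab]] by (simp add: v_def)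
  have "\<exists>X \<subseteq> N (\<phi> b). odd (card X) = (\<phi> b = s) \<and> (\<forall>u \<in> N (\<phi> b). \<forall>t. R u t \<longrightarrow> (u \<in> X) = t)"
  proof (rule parity_completion[OF finite_N])
    show "t = t'" if "R u t" "R u t'" for u t t'
      using that forced_unique_kind unfolding R_def by (metis (full_types))
    fix g assume g: "\<forall>u \<in> N (\<phi> b). R u (g u)"
    have "forced a b (odd (card {u \<in> N (\<phi> b). u \<noteq> \<phi> a \<and> g u}) \<noteq> (\<phi> b = s))"
      by (rule forced.sum[OF ab _ refl]) (use g in \<open>auto simp: R_def v_def\<close>)
    then have "\<tau> = (odd (card {u \<in> N (\<phi> b). u \<noteq> \<phi> a \<and> g u}) \<noteq> (\<phi> b = s))"
      using Y unfolding \<tau>_def by blast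
    moreover have "g v = \<tau>" using g v by (auto simp: R_def)
    ultimately show "odd (card {u \<in> N (\<phi> b). g u}) = (\<phi> b = s)"
      using odd_card_remove[OF finite_N v, of g] unfolding v_def by blast
  qed
  then obtain X where X: "X \<subseteq> N (\<phi> b)" "odd (card X) = (\<phi> b = s)"
    "\<And>u t. u \<in> N (\<phi> b) \<Longrightarrow> R u t \<Longrightarrow> (u \<in> X) = t" by blast
  have Xv: "(v \<in> X) = \<tau>" using X(3)[OF v] by (simp add: R_def)
  \<comment> \<open>A child over \<open>v\<close> shares its value with the entering edge. By rule
    \<open>pass\<close> what it forces was already forced there, hence respected by
    \<open>Y\<close>.\<close>
  have "(\<phi> c \<in> X) = t" if c: "(b, c) \<in> E" "c \<noteq> a" "forced b c t" for c t
  proof (cases "\<phi> c = v")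
    case True
    then have "forced a b t" using forced.pass[OF ab c(1,2) _ c(3)] by (simp add: v_def)
    then show ?thesis using Y Xv True by (simp add: \<tau>_def)
  next
    case False
    then show ?thesis using X(3)[of "\<phi> c" t] hom[OF c(1)] c unfolding R_def by auto
  qed
  then show "\<exists>X. (X \<subseteq> N (\<phi> b) \<and> odd (card X) = (\<phi> b = s)) \<and> (\<phi> b \<in> Y) = (\<phi> a \<in> X) \<and>
      (\<forall>c. (b, c) \<in> E \<longrightarrow> c \<noteq> a \<longrightarrow> (\<forall>t. forced b c t \<longrightarrow> (\<phi> c \<in> X) = t))"
    using X(1,2) Xv unfolding v_def \<tau>_def by blast
qed blast

end

text \<open>Only edges inside \<open>Z\<close> receive nonzero values. At a vertex over
  \<open>Z\<close> one edge value may be inherited, but a second neighbour in \<open>Z\<close> is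
  still free to repair the parity.\<close>

lemma (in forest_rel) parity_system_solvable_core:
  assumes hom: "\<And>a b. (a, b) \<in> E \<Longrightarrow> (\<phi> a, \<phi> b) \<in> A" and "finite V" "s \<in> Z"
    and A: "\<And>v w. (v, w) \<in> A \<Longrightarrow> (w, v) \<in> A"
    and core: "\<And>z v. z \<in> Z \<Longrightarrow> \<exists>u \<in> Z. (z, u) \<in> A \<and> u \<noteq> v"
  shows "\<exists>X. (\<forall>b \<in> V. X b \<subseteq> {u. (\<phi> b, u) \<in> A} \<and> (odd (card (X b)) \<longleftrightarrow> \<phi> b = s)) \<and>
    (\<forall>a \<in> V. \<forall>b \<in> V. (a, b) \<in> E \<longrightarrow> (\<phi> b \<in> X a \<longleftrightarrow> \<phi> a \<in> X b))"
proof -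
  define Adm where "Adm = (\<lambda>b X. X \<subseteq> {u \<in> Z. (\<phi> b, u) \<in> A} \<and> (\<phi> b \<notin> Z \<longrightarrow> X = {}) \<and>
    (odd (card X) \<longleftrightarrow> \<phi> b = s))"
  have choose: "\<exists>X. Adm b X \<and> (t \<longleftrightarrow> v \<in> X)"
    if "t \<Longrightarrow> \<phi> b \<in> Z \<and> v \<in> Z \<and> (\<phi> b, v) \<in> A" for b v t
  proof (cases "\<phi> b \<in> Z")
    case True
    then obtain u where u: "u \<in> Z" "(\<phi> b, u) \<in> A" "u \<noteq> v" using core by blast
    \<comment> \<open>\<open>v\<close> carries the inherited value, and \<open>u\<close> is added
      exactly when the parity is still wrong.\<close>
    let ?X = "(if t then {v} else {}) \<union> (if t = (\<phi> b = s) then {} else {u})"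
    have "Adm b ?X \<and> (t \<longleftrightarrow> v \<in> ?X)"
      using u that True unfolding Adm_def by auto
    then show ?thesis by blast
  next
    case False
    then show ?thesis using that \<open>s \<in> Z\<close> unfolding Adm_def by (intro exI[of _ "{}"]) auto
  qed
  have "\<exists>X. (\<forall>b \<in> V. Adm b (X b)) \<and>
    (\<forall>a \<in> V. \<forall>b \<in> V. (a, b) \<in> E \<longrightarrow> (\<phi> b \<in> X a \<longleftrightarrow> \<phi> a \<in> X b))"
  proof (rule propagate[OF \<open>finite V\<close>, where I = "\<lambda>_ _ _. True"])
    show "\<exists>X. Adm b X \<and> (\<forall>c. (b, c) \<in> E \<longrightarrow> True)" for b using choose[of False b] by blast
    fix a b Y assume "(a, b) \<in> E" "Adm a Y"
    then have "\<phi> b \<in> Z \<and> \<phi> a \<in> Z \<and> (\<phi> b, \<phi> a) \<in> A" if "\<phi> b \<in> Y"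
      using that hom A unfolding Adm_def by blast
    then show "\<exists>X. Adm b X \<and> (\<phi> b \<in> Y) = (\<phi> a \<in> X) \<and> (\<forall>c. (b, c) \<in> E \<longrightarrow> c \<noteq> a \<longrightarrow> True)"
      using choose[of "\<phi> b \<in> Y" b "\<phi> a"] by blast
  qed blast
  then obtain X where X: "\<forall>b \<in> V. Adm b (X b)"
    "\<forall>a \<in> V. \<forall>b \<in> V. (a, b) \<in> E \<longrightarrow> (\<phi> b \<in> X a \<longleftrightarrow> \<phi> a \<in> X b)" by blast
  then show ?thesis unfolding Adm_def by (intro exI[of _ X]) blast
qed

section \<open>Twisted graphs\<close>

abbreviation nbrs :: "'a pair_pre_digraph \<Rightarrow> 'a \<Rightarrow> 'a set" where
  "nbrs F v \<equiv> {u. (v, u) \<in> parcs F}"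

text \<open>The graphs to be compared must live on natural numbers, so pairs of a vertex and a
  finite set of vertices are coded as numbers.\<close>

definition enc :: "nat \<Rightarrow> nat set \<Rightarrow> nat" where
  "enc v S = prod_encode (v, set_encode S)"

definition base :: "nat \<Rightarrow> nat" where
  "base n = fst (prod_decode n)"

definition label :: "nat \<Rightarrow> nat set" where
  "label n = set_decode (snd (prod_decode n))"

lemma base_enc [simp]: "base (enc v S) = v"
  by (simp add: base_def enc_def)

lemma label_enc [simp]: "finite S \<Longrightarrow> label (enc v S) = S"
  by (simp add: label_def enc_def)

lemma enc_base_label [simp]: "enc (base n) (label n) = n"
  by (simp add: base_def label_def enc_def set_decode_inverse)

lemma finite_label [simp]: "finite (label n)"
  by (simp add: label_def)

text \<open>
  The Cai--Fuerer--Immerman graph of \<open>F\<close>, twisted at \<open>U\<close>: the vertex \<open>enc v S\<close> is the pair of a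
  vertex \<open>v\<close> and a set \<open>S\<close> of neighbours of \<open>v\<close>, which stands for the set of edges from \<open>v\<close> to \<open>S\<close>.
\<close>

definition cfi :: "nat pair_pre_digraph \<Rightarrow> nat set \<Rightarrow> nat pair_pre_digraph" where
  "cfi F U =
    (let V = {n. base n \<in> pverts F \<and> label n \<subseteq> nbrs F (base n) \<and> (odd (card (label n)) \<longleftrightarrow> base n \<in> U)}
     in \<lparr> pverts = V, parcs = {(m, n). m \<in> V \<and> n \<in> V \<and> (base m, base n) \<in> parcs F \<and>
       (base n \<in> label m \<longleftrightarrow> base m \<in> label n)} \<rparr>)"

lemma pverts_cfi: "n \<in> pverts (cfi F U) \<longleftrightarrow>
    base n \<in> pverts F \<and> label n \<subseteq> nbrs F (base n) \<and> (odd (card (label n)) \<longleftrightarrow> base n \<in> U)"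
  by (simp add: cfi_def Let_def)

lemma parcs_cfi: "(m, n) \<in> parcs (cfi F U) \<longleftrightarrow> m \<in> pverts (cfi F U) \<and> n \<in> pverts (cfi F U) \<and>
    (base m, base n) \<in> parcs F \<and> (base n \<in> label m \<longleftrightarrow> base m \<in> label n)"
  by (simp add: cfi_def Let_def)

lemma pair_graphI:
  assumes "finite (pverts G)" "\<And>a b. (a, b) \<in> parcs G \<Longrightarrow> a \<in> pverts G \<and> (b, a) \<in> parcs G \<and> a \<noteq> b"
  shows "pair_graph G"
proof -
  have "parcs G \<subseteq> pverts G \<times> pverts G" using assms(2) by auto
  then have "finite (parcs G)" using assms(1) finite_subset by blast
  with \<open>parcs G \<subseteq> _\<close> show ?thesis
    using assms by unfold_locales (auto simp: symmetric_def sym_def)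
qed

lemma pair_graphD:
  assumes "pair_graph G"
  shows "finite (pverts G)" "finite (parcs G)"
    and "(a, b) \<in> parcs G \<Longrightarrow> a \<in> pverts G" "(a, b) \<in> parcs G \<Longrightarrow> b \<in> pverts G"
    and "(a, b) \<in> parcs G \<Longrightarrow> (b, a) \<in> parcs G" "(a, b) \<in> parcs G \<Longrightarrow> a \<noteq> b"
proof -
  interpret pair_graph G by fact
  show "finite (pverts G)" "finite (parcs G)"
    and "(a, b) \<in> parcs G \<Longrightarrow> a \<in> pverts G" "(a, b) \<in> parcs G \<Longrightarrow> b \<in> pverts G"
    and "(a, b) \<in> parcs G \<Longrightarrow> (b, a) \<in> parcs G" "(a, b) \<in> parcs G \<Longrightarrow> a \<noteq> b"
    using pair_finite_verts pair_finite_arcs wellformed' arcs_symmetric no_loops' by blast+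
qed

lemma finite_nbrs: "pair_graph F \<Longrightarrow> finite (nbrs F v)"
  by (rule finite_subset[of _ "pverts F"]) (auto dest: pair_graphD)

lemma pair_graph_cfi:
  assumes "pair_graph F"
  shows "pair_graph (cfi F U)"
proof (rule pair_graphI)
  have "pverts (cfi F U) \<subseteq> case_prod enc ` (pverts F \<times> Pow (pverts F))"
  proof
    fix n assume "n \<in> pverts (cfi F U)"
    then have "(base n, label n) \<in> pverts F \<times> Pow (pverts F)"
      using pair_graphD(4)[OF assms] by (auto simp: pverts_cfi)
    then show "n \<in> case_prod enc ` (pverts F \<times> Pow (pverts F))"
      by (intro image_eqI[of _ _ "(base n, label n)"]) auto
  qed
  then show "finite (pverts (cfi F U))"
    using pair_graphD(1)[OF assms] finite_subset by blast
  show "a \<in> pverts (cfi F U) \<and> (b, a) \<in> parcs (cfi F U) \<and> a \<noteq> b" if "(a, b) \<in> parcs (cfi F U)" for a b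
    using that pair_graphD(5,6)[OF assms] by (auto simp: parcs_cfi)
qed

text \<open>The linear system for lifting \<open>\<phi>\<close> to \<open>cfi F U\<close>:
  \<open>X a\<close> is the label sought over \<open>\<phi> a\<close>, the first condition is its
  vertex equation and the second makes labels agree along edges.\<close>

definition twist_solution ::
  "nat pair_pre_digraph \<Rightarrow> nat set \<Rightarrow> 'a pair_pre_digraph \<Rightarrow> ('a \<Rightarrow> nat) \<Rightarrow> ('a \<Rightarrow> nat set) \<Rightarrow> bool" where
  "twist_solution F U F' \<phi> X \<longleftrightarrow>
    (\<forall>a \<in> pverts F'. X a \<subseteq> nbrs F (\<phi> a) \<and> (odd (card (X a)) \<longleftrightarrow> \<phi> a \<in> U)) \<and>
    (\<forall>(a, b) \<in> parcs F'. \<phi> b \<in> X a \<longleftrightarrow> \<phi> a \<in> X b)"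

definition proj :: "'a pair_pre_digraph \<Rightarrow> ('a \<Rightarrow> nat) \<Rightarrow> 'a \<Rightarrow> nat" where
  "proj F' h = restrict (base \<circ> h) (pverts F')"

definition shift :: "'a pair_pre_digraph \<Rightarrow> ('a \<Rightarrow> nat set) \<Rightarrow> ('a \<Rightarrow> nat) \<Rightarrow> 'a \<Rightarrow> nat" where
  "shift F' X h = restrict (\<lambda>a. enc (base (h a)) (sym_diff (label (h a)) (X a))) (pverts F')"

section \<open>Translating lifts by solutions of the linear system\<close>

lemma odd_card_sym_diff:
  assumes "finite A" "finite B"
  shows "odd (card (sym_diff A B)) \<longleftrightarrow> odd (card A) \<noteq> odd (card B)"
proof -
  have "sym_diff A B = {u \<in> A \<union> B. (u \<in> A) \<noteq> (u \<in> B)}" "{u \<in> A \<union> B. u \<in> A} = A" "{u \<in> A \<union> B. u \<in> B} = B"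
    by auto
  then show ?thesis
    using odd_card_disagree[of "A \<union> B" "\<lambda>u. u \<in> A" "\<lambda>u. u \<in> B"] assms by simp
qed

context
  fixes F :: "nat pair_pre_digraph" and F' :: "'a pair_pre_digraph" and U :: "nat set"
  assumes F: "pair_graph F" and F': "pair_graph F'"
begin

lemma proj_hom:
  assumes "h \<in> homs F' (cfi F U)"
  shows "proj F' h \<in> homs F' F"
proof -
  have "base (h a) \<in> pverts F" if "a \<in> pverts F'" for a
    using assms that by (auto simp: homs_def pverts_cfi)
  moreover have "(base (h a), base (h b)) \<in> parcs F" if "(a, b) \<in> parcs F'" for a b
    using assms that by (auto simp: homs_def parcs_cfi)
  ultimately show ?thesis
    using pair_graphD(3,4)[OF F'] by (auto simp: homs_def proj_def)
qed

lemma twist_solution_finite: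
  "twist_solution F U F' \<phi> X \<Longrightarrow> a \<in> pverts F' \<Longrightarrow> finite (X a)"
  by (rule finite_subset[OF _ finite_nbrs[OF F, of "\<phi> a"]]) (simp add: twist_solution_def)

lemma shift_hom:
  assumes h: "h \<in> homs F' (cfi F U')" and X: "twist_solution F U F' (proj F' h) X"
    and U'': "\<And>v. v \<in> U'' \<longleftrightarrow> (v \<in> U') \<noteq> (v \<in> U)"
  shows "shift F' X h \<in> homs F' (cfi F U'')"
proof -
  have X1: "X a \<subseteq> nbrs F (base (h a))" "odd (card (X a)) \<longleftrightarrow> base (h a) \<in> U" "finite (X a)"
    if "a \<in> pverts F'" for a
    using X that twist_solution_finite[OF X that] unfolding twist_solution_def proj_def by auto
  have X2: "base (h b) \<in> X a \<longleftrightarrow> base (h a) \<in> X b" if "(a, b) \<in> parcs F'" for a b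
    using X that pair_graphD(3,4)[OF F' that] unfolding twist_solution_def proj_def by auto
  have h1: "h a \<in> pverts (cfi F U')" if "a \<in> pverts F'" for a
    using h that unfolding homs_def by blast
  have h2: "(h a, h b) \<in> parcs (cfi F U')" if "(a, b) \<in> parcs F'" for a b
    using h that unfolding homs_def by blast
  have s1: "shift F' X h a \<in> pverts (cfi F U'')" if "a \<in> pverts F'" for a
    using h1[OF that] X1[OF that] that odd_card_sym_diff[OF finite_label X1(3)[OF that], of "h a"]
    unfolding pverts_cfi shift_def U'' by auto
  have "(shift F' X h a, shift F' X h b) \<in> parcs (cfi F U'')" if "(a, b) \<in> parcs F'" for a b
    using h2[OF that] X2[OF that] s1 pair_graphD(3,4)[OF F' that] X1(3)
    unfolding parcs_cfi by (auto simp: shift_def)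
  moreover have "shift F' X h \<in> pverts F' \<rightarrow>\<^sub>E pverts (cfi F U'')"
    using s1 by (intro PiE_I) (auto simp: shift_def)
  ultimately show ?thesis unfolding homs_def by blast
qed

lemma proj_shift: "proj F' (shift F' X h) = proj F' h"
  by (auto simp: proj_def shift_def)

lemma shift_shift:
  assumes "h \<in> homs F' (cfi F U')" "\<And>a. a \<in> pverts F' \<Longrightarrow> finite (X a)"
  shows "shift F' X (shift F' X h) = h"
proof
  fix a
  have "sym_diff (sym_diff A B) B = A" for A B :: "nat set" by blast
  then show "shift F' X (shift F' X h) a = h a"
    using assms by (auto simp: shift_def homs_def PiE_def extensional_def)
qed

text \<open>Lifts of \<open>\<phi>\<close> to the twisted graph are themselves solutions over
  \<open>\<phi>\<close>. Wherever a solution exists, translation by a fixed one is a bijection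
  between untwisted and twisted lifts.\<close>

lemma hom_count_cfi:
  "hom_count F' (cfi F U) =
    card {h \<in> homs F' (cfi F {}). \<exists>X. twist_solution F U F' (proj F' h) X}"
proof -
  define X where "X = (\<lambda>\<phi>. SOME X. twist_solution F U F' \<phi> X)"
  \<comment> \<open>The chosen solution depends only on the projection, which \<open>shift\<close>
    preserves, so \<open>\<theta>\<close> is its own inverse.\<close>
  define \<theta> where "\<theta> = (\<lambda>h. shift F' (X (proj F' h)) h)"
  let ?S = "{h \<in> homs F' (cfi F {}). \<exists>X. twist_solution F U F' (proj F' h) X}"
  have X: "twist_solution F U F' \<phi> (X \<phi>)" if "\<exists>X. twist_solution F U F' \<phi> X" for \<phi>
    unfolding X_def using someI_ex[OF that] .
  have sol: "\<exists>X. twist_solution F U F' (proj F' h) X" if h: "h \<in> homs F' (cfi F U)" for h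
  proof (intro exI)
    have "h a \<in> pverts (cfi F U)" if "a \<in> pverts F'" for a using h that unfolding homs_def by blast
    moreover have "(h a, h b) \<in> parcs (cfi F U)" if "(a, b) \<in> parcs F'" for a b
      using h that unfolding homs_def by blast
    ultimately show "twist_solution F U F' (proj F' h) (label \<circ> h)"
      using pair_graphD(3,4)[OF F'] unfolding twist_solution_def proj_def pverts_cfi parcs_cfi by auto
  qed
  have \<theta>\<theta>: "\<theta> (\<theta> h) = h" if "h \<in> homs F' (cfi F U')" "\<exists>X. twist_solution F U F' (proj F' h) X" for h U'
    unfolding \<theta>_def proj_shift
    by (rule shift_shift[OF that(1)]) (rule twist_solution_finite[OF X[OF that(2)]])
  have "bij_betw \<theta> ?S (homs F' (cfi F U))"
  proof (rule bij_betw_byWitness[where f' = \<theta>])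
    show "\<forall>h \<in> ?S. \<theta> (\<theta> h) = h" "\<forall>h \<in> homs F' (cfi F U). \<theta> (\<theta> h) = h"
      using \<theta>\<theta> sol by blast+
    show "\<theta> ` ?S \<subseteq> homs F' (cfi F U)"
      using shift_hom[of _ "{}" "X _" U] X unfolding \<theta>_def by auto
    show "\<theta> ` homs F' (cfi F U) \<subseteq> ?S"
      using shift_hom[of _ U "X _" "{}"] X sol unfolding \<theta>_def by (auto simp: proj_shift)
  qed
  then show ?thesis unfolding hom_count_def by (simp add: bij_betw_same_card)
qed

end

lemma hom_count_cfi_eq:
  assumes "pair_graph F" "pair_graph F'"
    and "\<And>\<phi>. \<phi> \<in> homs F' F \<Longrightarrow> \<exists>X. twist_solution F U F' \<phi> X"
  shows "hom_count F' (cfi F U) = hom_count F' (cfi F {})"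
proof -
  have "{h \<in> homs F' (cfi F {}). \<exists>X. twist_solution F U F' (proj F' h) X} = homs F' (cfi F {})"
    using assms proj_hom by blast
  then show ?thesis unfolding hom_count_cfi[OF assms(1,2), of U] unfolding hom_count_def by simp
qed

section \<open>Handshake lemma and strict drop of the count for \<open>F\<close> itself\<close>

lemma even_card_symmetric:
  fixes R :: "nat rel"
  assumes "finite R" "sym R" "irrefl R"
  shows "even (card R)"
proof -
  define A where "A = {(a, b) \<in> R. a < b}"
  have "e \<in> A \<union> prod.swap ` A" if "e \<in> R" for e
  proof -
    obtain a b where e: "e = (a, b)" by (cases e)
    then have "a \<noteq> b" "(b, a) \<in> R" using that assms(2,3) unfolding sym_def irrefl_def by auto
    then show ?thesis using e that unfolding A_def by (cases "a < b") (auto simp: image_iff)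
  qed
  moreover have "A \<union> prod.swap ` A \<subseteq> R" using assms(2) unfolding A_def sym_def by auto
  ultimately have "R = A \<union> prod.swap ` A" by blast
  moreover have "A \<inter> prod.swap ` A = {}" unfolding A_def by auto
  moreover have "finite A" using assms(1) by (rule rev_finite_subset) (auto simp: A_def)
  ultimately have "card R = card A + card (prod.swap ` A)" by (metis card_Un_disjoint finite_imageI)
  also have "card (prod.swap ` A) = card A" by (intro card_image) (auto simp: inj_on_def)
  finally show ?thesis by simp
qed

text \<open>A solution over the identity would be a spanning subgraph of \<open>F\<close> in which
  \<open>s\<close> is the only vertex of odd degree.\<close>

lemma no_twist_solution_id:
  assumes F: "pair_graph F" and s: "s \<in> pverts F"
  shows "\<not> twist_solution F {s} F (\<lambda>a \<in> pverts F. a) X"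
proof
  assume "twist_solution F {s} F (\<lambda>a \<in> pverts F. a) X"
  then have X: "\<And>a. a \<in> pverts F \<Longrightarrow> X a \<subseteq> nbrs F a \<and> (odd (card (X a)) \<longleftrightarrow> a = s)"
    and X': "\<And>a b. (a, b) \<in> parcs F \<Longrightarrow> b \<in> X a \<longleftrightarrow> a \<in> X b"
    using pair_graphD(3,4)[OF F] unfolding twist_solution_def by fastforce+
  define R where "R = Sigma (pverts F) X"
  have fin: "finite (X a)" if "a \<in> pverts F" for a
    using X[OF that] finite_nbrs[OF F] finite_subset by blast
  have "finite R" unfolding R_def using fin pair_graphD(1)[OF F] by blast
  moreover have "sym R" unfolding R_def sym_def using X X' pair_graphD(4)[OF F] by blast
  moreover have "irrefl R" unfolding R_def irrefl_def using X pair_graphD(6)[OF F] by blast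
  ultimately have "even (card R)" by (rule even_card_symmetric)
  moreover have "card R = (\<Sum>a \<in> pverts F. card (X a))"
    unfolding R_def using fin pair_graphD(1)[OF F] by (simp add: card_SigmaI)
  moreover have "{a \<in> pverts F. odd (card (X a))} = {s}" using X s by blast
  ultimately show False using even_sum_iff[OF pair_graphD(1)[OF F], of "\<lambda>a. card (X a)"] by simp
qed

lemma finite_homs:
  assumes "finite (pverts F)" "finite (pverts G)"
  shows "finite (homs F G)"
proof -
  have "homs F G \<subseteq> pverts F \<rightarrow>\<^sub>E pverts G" by (auto simp: homs_def)
  then show ?thesis using finite_PiE[of "pverts F" "\<lambda>_. pverts G"] assms finite_subset by blast
qed

lemma hom_count_cfi_less:
  assumes F: "pair_graph F" and s: "s \<in> pverts F"
  shows "hom_count F (cfi F {s}) < hom_count F (cfi F {})"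
proof -
  \<comment> \<open>The zero section: it lies over the identity, so it is an untwisted homomorphism
    not counted for the twisted graph.\<close>
  define h where "h = (\<lambda>a \<in> pverts F. enc a {})"
  have h: "h \<in> homs F (cfi F {})"
    using pair_graphD(3,4)[OF F] by (auto simp: h_def homs_def pverts_cfi parcs_cfi)
  moreover have "proj F h = (\<lambda>a \<in> pverts F. a)" by (auto simp: proj_def h_def)
  ultimately have "{h \<in> homs F (cfi F {}). \<exists>X. twist_solution F {s} F (proj F h) X} \<subset> homs F (cfi F {})"
    using no_twist_solution_id[OF F s] by (intro psubsetI) (blast, force)
  moreover have "finite (homs F (cfi F {}))"
    using finite_homs pair_graphD(1)[OF F] pair_graphD(1)[OF pair_graph_cfi[OF F]] by blast
  ultimately show ?thesis
    unfolding hom_count_cfi[OF F F, of "{s}"] unfolding hom_count_def by (rule psubset_card_mono[rotated])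
qed

section \<open>Graph classes\<close>

lemma rev_path_vwalk_arcs: "rev_path (vwalk_arcs p) = vwalk_arcs (rev p)"
proof (induction p)
  case (Cons x p)
  then show ?case by (cases "p = []") (simp_all add: vwalk_arcs_append last_rev)
qed simp

lemma set_vwalk_arcs_subset:
  "successively (\<lambda>x y. (x, y) \<in> E) p \<Longrightarrow> set (vwalk_arcs p) \<subseteq> E"
  by (induction p rule: vwalk_arcs.induct) auto

lemma pcas_vwalk_arcs: "p \<noteq> [] \<Longrightarrow> pcas (hd p) (vwalk_arcs p) (last p)"
  by (induction p rule: vwalk_arcs.induct) auto

lemma pawalk_verts_vwalk_arcs: "p \<noteq> [] \<Longrightarrow> pawalk_verts (hd p) (vwalk_arcs p) = p"
  by (induction p rule: vwalk_arcs.induct) auto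

lemma map_fst_vwalk_arcs: "map fst (vwalk_arcs p) = butlast p"
  by (induction p rule: vwalk_arcs.induct) auto

lemma path_apath:
  assumes "path (parcs G) a p b" "a \<in> pverts G"
  shows "pre_digraph.apath (with_proj G) a (vwalk_arcs p) b"
    and "pre_digraph.awalk_verts (with_proj G) a (vwalk_arcs p) = p"
  using assms set_vwalk_arcs_subset[of "parcs G" p] pcas_vwalk_arcs[of p] pawalk_verts_vwalk_arcs[of p]
  unfolding path_def pre_digraph.apath_def pre_digraph.awalk_def cas_with_proj_eq awalk_verts_with_proj_eq
  by auto

lemma path_mono: "path E a p b \<Longrightarrow> E \<subseteq> E' \<Longrightarrow> path E' a p b"
  unfolding path_def by (auto elim: successively_mono)

lemma forest_graph_forest_rel:
  assumes "forest_graph F"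
  shows "forest_rel (parcs F)"
proof (rule ccontr)
  assume "\<not> forest_rel (parcs F)"
  have F: "pair_graph F" using assms unfolding forest_graph_def simple_graph_def by blast
  obtain b p where p: "p \<noteq> []" "hd p \<noteq> last p" "distinct (b # p)"
    "successively (\<lambda>x y. (x, y) \<in> parcs F) (b # p @ [b])"
    using exists_cycle[OF pair_graphD(2,5,6)[OF F] \<open>\<not> forest_rel (parcs F)\<close>] by blast
  let ?q = "vwalk_arcs (b # p @ [b])"
  \<comment> \<open>Distinct ends give \<open>p\<close> two vertices, so the closed walk through
    \<open>b\<close> has at least three arcs.\<close>
  have "length p \<ge> 2" using p(1,2) by (cases p; cases "tl p") auto
  then have "length ?q \<ge> 3" using vwalk_length_simp[of "b # p @ [b]"] unfolding vwalk_length_def by simp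
  moreover have "pre_digraph.cycle (with_proj F) ?q"
    unfolding pre_digraph.cycle_def pre_digraph.awalk_def cas_with_proj_eq awalk_verts_with_proj_eq
  proof (intro exI conjI)
    show "b \<in> verts (with_proj F)"
      using p(1,4) pair_graphD(3)[OF F] by (cases p) auto
    show "set ?q \<subseteq> arcs (with_proj F)" using set_vwalk_arcs_subset[OF p(4)] by simp
    show "pcas b ?q b" using pcas_vwalk_arcs[of "b # p @ [b]"] by simp
    show "distinct (tl (pawalk_verts b ?q))"
      using pawalk_verts_vwalk_arcs[of "b # p @ [b]"] p(3) by simp
    show "?q \<noteq> []" using \<open>length ?q \<ge> 3\<close> by auto
  qed
  ultimately show False using assms unfolding forest_graph_def by blast
qed

lemma top_emb_topological_minor:
  assumes emb: "top_emb E (parcs K) (pverts K) \<rho> P" and K: "pair_graph K"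
    and E: "E \<subseteq> parcs F" and \<rho>: "\<rho> ` pverts K \<subseteq> pverts F"
  shows "topological_minor K F"
  unfolding topological_minor_def
proof (intro exI conjI)
  let ?P = "\<lambda>(v, w). vwalk_arcs (P v w)"
  show "inj_on \<rho> (pverts K)" using emb unfolding top_emb_def by blast
  show "\<rho> ` pverts K \<subseteq> pverts F" by fact
  have verts: "v \<in> pverts K" "w \<in> pverts K" if "(v, w) \<in> parcs K" for v w
    using that pair_graphD(3,4)[OF K] by blast+
  have path: "path (parcs F) (\<rho> v) (P v w) (\<rho> w)" "P w v = rev (P v w)" "\<rho> v \<in> pverts F"
    if "(v, w) \<in> parcs K" for v w
    using path_mono[OF _ E] top_embD(1,2)[OF emb verts[OF that] that] \<rho> verts[OF that] by blast+
  have "pre_digraph.apath (with_proj F) (\<rho> v) (?P (v, w)) (\<rho> w) \<and> ?P (w, v) = rev_path (?P (v, w))"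
    if "(v, w) \<in> parcs K" for v w
    using path_apath(1)[OF path(1,3)[OF that]] path(2)[OF that] by (simp add: rev_path_vwalk_arcs)
  then show "\<forall>(v, w) \<in> parcs K. pre_digraph.apath (with_proj F) (\<rho> v) (?P (v, w)) (\<rho> w) \<and>
      ?P (w, v) = rev_path (?P (v, w))" by blast
  have "set (pre_digraph.inner_verts (with_proj F) (?P (v, w))) \<inter>
      set (pre_digraph.awalk_verts (with_proj F) (\<rho> x) (?P (x, y))) = {}"
    if vw: "(v, w) \<in> parcs K" and xy: "(x, y) \<in> parcs K" and ne: "{v, w} \<noteq> {x, y}" for v w x y
  proof -
    have "pre_digraph.inner_verts (with_proj F) (?P (v, w)) = tl (butlast (P v w))"
      by (simp add: pre_digraph.inner_verts_def map_fst_vwalk_arcs)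
    moreover have "pre_digraph.awalk_verts (with_proj F) (\<rho> x) (?P (x, y)) = P x y"
      using path_apath(2)[OF path(1,3)] xy by simp
    moreover have "set (P v w) \<inter> set (P x y) \<subseteq> \<rho> ` {v, w}"
      using top_embD(3)[OF emb verts[OF vw] vw verts[OF xy] xy ne] by blast
    moreover have "set (tl (butlast (P v w))) \<subseteq> set (P v w)"
      by (metis in_set_butlastD list.sel(2) list.set_sel(2) subsetI)
    \<comment> \<open>Two paths share only images of end vertices, and by distinctness these are not
      inner vertices.\<close>
    moreover have "\<rho> v \<notin> set (tl (butlast (P v w)))" "\<rho> w \<notin> set (tl (butlast (P v w)))"
    proof -
      have p: "P v w \<noteq> []" "hd (P v w) = \<rho> v" "last (P v w) = \<rho> w" "distinct (P v w)"
        using path(1)[OF vw] unfolding path_def by auto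
      obtain q where q: "P v w = q @ [\<rho> w]" using p by (metis append_butlast_last_id)
      then show "\<rho> v \<notin> set (tl (butlast (P v w)))" "\<rho> w \<notin> set (tl (butlast (P v w)))"
        using p by (cases q; auto)+
    qed
    ultimately show ?thesis by auto
  qed
  then show "\<forall>(v, w) \<in> parcs K. \<forall>(x, y) \<in> parcs K. {v, w} \<noteq> {x, y} \<longrightarrow>
      set (pre_digraph.inner_verts (with_proj F) (?P (v, w))) \<inter>
      set (pre_digraph.awalk_verts (with_proj F) (\<rho> x) (?P (x, y))) = {}"
    by blast
qed

section \<open>Unions of components and the choice of a component outside the class\<close>

definition induced :: "'a pair_pre_digraph \<Rightarrow> 'a set \<Rightarrow> 'a pair_pre_digraph" where
  "induced F W = \<lparr> pverts = W, parcs = {(a, b) \<in> parcs F. a \<in> W \<and> b \<in> W} \<rparr>"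

lemma induced_simps [simp]:
  "pverts (induced F W) = W" "parcs (induced F W) = {(a, b) \<in> parcs F. a \<in> W \<and> b \<in> W}"
  by (simp_all add: induced_def)

lemma pair_graph_induced: "pair_graph F \<Longrightarrow> W \<subseteq> pverts F \<Longrightarrow> pair_graph (induced F W)"
  by (rule pair_graphI) (auto dest: pair_graphD finite_subset)

lemma induced_pverts: "pair_graph F \<Longrightarrow> induced F (pverts F) = F"
  by (cases F) (auto simp: induced_def dest: pair_graphD)

definition adj_closed :: "'a pair_pre_digraph \<Rightarrow> 'a set \<Rightarrow> bool" where
  "adj_closed F W \<longleftrightarrow> W \<subseteq> pverts F \<and> (\<forall>(a, b) \<in> parcs F. a \<in> W \<longrightarrow> b \<in> W)"

lemma induced_union:
  fixes F :: "nat pair_pre_digraph"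
  assumes F: "pair_graph F" and C: "union_closed C"
    and W: "adj_closed F W" "adj_closed F W'" "W \<inter> W' = {}"
    and "induced F W \<in> C" "induced F W' \<in> C"
  shows "induced F (W \<union> W') \<in> C"
proof -
  let ?D = "disjoint_union (induced F W) (induced F W')"
  let ?f = "case_sum id id :: nat + nat \<Rightarrow> nat"
  define i where "i = \<lparr> iso_verts = ?f, iso_arcs = map_prod ?f ?f, iso_head = snd, iso_tail = fst \<rparr>"
  have verts: "pverts ?D = W <+> W'" by (simp add: disjoint_union_def)
  have arcs: "parcs ?D = map_prod Inl Inl ` parcs (induced F W) \<union> map_prod Inr Inr ` parcs (induced F W')"
    by (simp add: disjoint_union_def)
  have sub: "parcs ?D \<subseteq> pverts ?D \<times> pverts ?D" unfolding verts arcs by auto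
  have inj: "inj_on ?f (W <+> W')" using W(3) by (auto simp: inj_on_def)
  have inj': "inj_on (map_prod ?f ?f) (parcs ?D)"
    using map_prod_inj_on[OF inj inj] sub inj_on_subset unfolding verts by blast
  have iv: "?f ` (W <+> W') = W \<union> W'" by (force simp: Plus_def image_Un image_image)
  have "map_prod ?f ?f ` parcs ?D = parcs (induced F W) \<union> parcs (induced F W')"
    unfolding arcs image_Un image_image by (simp add: prod.map_comp o_def case_prod_unfold map_prod_def)
  \<comment> \<open>Closure under adjacency excludes arcs between \<open>W\<close> and
    \<open>W'\<close>.\<close>
  also have "\<dots> = parcs (induced F (W \<union> W'))"
    using W pair_graphD(5)[OF F] unfolding adj_closed_def by auto
  finally have ia: "map_prod ?f ?f ` parcs ?D = parcs (induced F (W \<union> W'))" .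
  have "wf_digraph (with_proj ?D)" using sub by (auto simp: wf_digraph_def)
  then have "pre_digraph.digraph_isomorphism (with_proj ?D) i"
    unfolding pre_digraph.digraph_isomorphism_def i_def using inj inj' by (simp add: verts)
  moreover have "with_proj (induced F (W \<union> W')) = app_iso i (with_proj ?D)"
    unfolding app_iso_def i_def with_proj_def using iv ia by (simp add: verts del: induced_simps(2))
  ultimately have "digraph_iso (with_proj ?D) (with_proj (induced F (W \<union> W')))"
    unfolding digraph_iso_def by blast
  then show ?thesis using C assms(6,7) unfolding union_closed_def by blast
qed

text \<open>A smallest closed \<open>W\<close> outside the class is a component: a proper closed
  part and its complement in \<open>W\<close> would both lie in the class by minimality, hence so
  would their union.\<close>

lemma exists_minimal_closed:
  assumes F: "simple_graph F" "F \<notin> C" and C: "union_closed C"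
  shows "\<exists>W. W \<noteq> {} \<and> adj_closed F W \<and> induced F W \<notin> C \<and>
    (\<forall>S. S \<noteq> {} \<longrightarrow> S \<subseteq> W \<longrightarrow> adj_closed F S \<longrightarrow> S = W)"
proof -
  have pF: "pair_graph F" "pverts F \<noteq> {}" using F(1) unfolding simple_graph_def by auto
  define Q where "Q = (\<lambda>W. W \<noteq> {} \<and> adj_closed F W \<and> induced F W \<notin> C)"
  have "Q (pverts F)"
    using pF F(2) pair_graphD(4)[OF pF(1)] by (auto simp: Q_def adj_closed_def induced_pverts)
  then obtain W where W: "Q W" and min: "\<And>W'. Q W' \<Longrightarrow> card W \<le> card W'"
    using ex_has_least_nat[of Q _ card] by blast
  have fin: "finite W"
    using W pair_graphD(1)[OF pF(1)] finite_subset unfolding Q_def adj_closed_def by blast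
  have "S = W" if S: "S \<noteq> {}" "S \<subseteq> W" "adj_closed F S" for S
  proof (rule ccontr)
    assume ne: "S \<noteq> W"
    have closed: "adj_closed F (W - S)"
      using S(3) W pair_graphD(5)[OF pF(1)] unfolding Q_def adj_closed_def by blast
    have "card S < card W" "card (W - S) < card W"
      using S ne fin by (auto intro!: psubset_card_mono)
    then have "\<not> Q S" "\<not> Q (W - S)" using min by (meson leD)+
    then have "induced F S \<in> C" "induced F (W - S) \<in> C"
      using S ne closed unfolding Q_def by auto
    moreover have "S \<union> (W - S) = W" "S \<inter> (W - S) = {}" using S(2) by auto
    ultimately have "induced F W \<in> C" using induced_union[OF pF(1) C S(3) closed] by metis
    then show False using W by (simp add: Q_def)
  qed
  then show ?thesis using W unfolding Q_def by blast
qed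

lemma tree_solvable:
  assumes F: "pair_graph F" "forest_rel (parcs F)" and F': "pair_graph F'" "forest_rel (parcs F')"
    and W: "adj_closed F W" "s \<in> W" "\<And>S. S \<noteq> {} \<Longrightarrow> S \<subseteq> W \<Longrightarrow> adj_closed F S \<Longrightarrow> S = W"
    and minor: "\<not> topological_minor (induced F W) F'" and \<phi>: "\<phi> \<in> homs F' F"
  shows "\<exists>X. twist_solution F {s} F' \<phi> X"
proof -
  define A where "A = parcs (induced F W)"
  define E where "E = {(a, b) \<in> parcs F'. \<phi> a \<in> W}"
  define V where "V = {a \<in> pverts F'. \<phi> a \<in> W}"
  have W1: "W \<subseteq> pverts F" and W2: "\<And>a b. (a, b) \<in> parcs F \<Longrightarrow> a \<in> W \<Longrightarrow> b \<in> W"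
    using W(1) unfolding adj_closed_def by auto
  have h: "(\<phi> a, \<phi> b) \<in> parcs F" if "(a, b) \<in> parcs F'" for a b
    using \<phi> that unfolding homs_def by blast
  have A: "forest_rel A"
    by (rule forest_rel_subset[OF F(2)]) (auto simp: A_def dest: pair_graphD(5)[OF F(1)])
  have E: "forest_rel E"
    by (rule forest_rel_subset[OF F'(2)]) (auto simp: E_def dest: pair_graphD(5)[OF F'(1)] h W2)
  interpret forest_pair E A using A E by (simp add: forest_pair_def)
  \<comment> \<open>What is reachable from \<open>w\<close> is closed under adjacency, so minimality
    makes it all of \<open>W\<close>.\<close>
  have W_eq: "insert w (\<Union>u \<in> {u. (w, u) \<in> A}. branch A w u) = W" (is "?D = W") if w: "w \<in> W" for w
  proof (rule W(3))
    have "y \<in> W" if "(w, u) \<in> A" "y \<in> branch A w u" for u y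
      using that(2) by (induction rule: branch_induct) (use that(1) in \<open>auto simp: A_def\<close>)
    then show "?D \<subseteq> W" using w by blast
    moreover have "z \<in> ?D" if y: "y \<in> ?D" and yz: "(y, z) \<in> parcs F" for y z
    proof -
      have yz': "(y, z) \<in> A" using y yz \<open>?D \<subseteq> W\<close> W2[OF yz] by (auto simp: A_def)
      show ?thesis
      proof (cases "y = w \<or> z = w")
        case True
        then show ?thesis using yz' branch_root[of z A w] by blast
      next
        case False
        then obtain u where "(w, u) \<in> A" "y \<in> branch A w u" using y by blast
        then show ?thesis using branch_step[OF _ yz'] False by blast
      qed
    qed
    ultimately show "adj_closed F ?D" using W1 unfolding adj_closed_def by blast
  qed simp
  interpret tree_target E A \<phi> s W V
  proof
    show "(\<phi> a, \<phi> b) \<in> A" if "(a, b) \<in> E" for a b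
      using that h W2 by (auto simp: E_def A_def)
    show "\<exists>u. (w, u) \<in> A \<and> s \<in> branch A w u" if "w \<in> W" "w \<noteq> s" for w
      using W_eq[OF that(1)] W(2) that(2) by blast
    show "v \<in> W" if "(v, w) \<in> A" for v w using that by (simp add: A_def)
    show "a \<in> V" if "(a, b) \<in> E" for a b
      using that pair_graphD(3)[OF F'(1)] by (auto simp: E_def V_def)
    show "\<phi> a \<in> W" if "a \<in> V" for a using that by (simp add: V_def)
    show "finite V" using pair_graphD(1)[OF F'(1)] by (simp add: V_def)
    show "\<not> full_emb A E w b" if w: "w \<in> W" and b: "b \<in> V" for w b
    proof
      assume "full_emb A E w b"
      from full_emb_top_emb[OF this] obtain \<rho> P where emb: "top_emb E A W \<rho> P" and "\<rho> w = b"
        and "\<rho> ` (\<Union>u \<in> {u. (w, u) \<in> A}. branch A w u) \<subseteq> snd ` E"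
        unfolding W_eq[OF w] by blast
      moreover have "snd ` E \<subseteq> pverts F'" using pair_graphD(4)[OF F'(1)] by (auto simp: E_def)
      moreover have "b \<in> pverts F'" using b by (simp add: V_def)
      ultimately have "\<rho> ` W \<subseteq> pverts F'" using W_eq[OF w] by blast
      then have "topological_minor (induced F W) F'"
        using emb pair_graph_induced[OF F(1) W1] unfolding A_def
        by (intro top_emb_topological_minor[of E "induced F W" \<rho> P F']) (auto simp: E_def)
      then show False using minor by blast
    qed
  qed
  obtain X where X: "\<And>b. b \<in> V \<Longrightarrow> X b \<subseteq> {u. (\<phi> b, u) \<in> A} \<and> (odd (card (X b)) \<longleftrightarrow> \<phi> b = s)"
    "\<And>a b. a \<in> V \<Longrightarrow> b \<in> V \<Longrightarrow> (a, b) \<in> E \<Longrightarrow> \<phi> b \<in> X a \<longleftrightarrow> \<phi> a \<in> X b"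
    using parity_system_solvable by blast
  \<comment> \<open>Off \<open>V\<close> the zero labels suffice because \<open>s\<close> lies in
    \<open>W\<close>; no edge of \<open>F'\<close> joins \<open>V\<close> to its complement.\<close>
  define Y where "Y = (\<lambda>a. if a \<in> V then X a else {})"
  have "Y a \<subseteq> nbrs F (\<phi> a) \<and> (odd (card (Y a)) \<longleftrightarrow> \<phi> a \<in> {s})" if "a \<in> pverts F'" for a
  proof (cases "a \<in> V")
    case True
    then show ?thesis using X(1)[OF True] by (auto simp: Y_def A_def)
  next
    case False
    then show ?thesis using that W(2) by (auto simp: Y_def V_def)
  qed
  moreover have "\<phi> b \<in> Y a \<longleftrightarrow> \<phi> a \<in> Y b" if ab: "(a, b) \<in> parcs F'" for a b
  proof -
    have "a \<in> V \<longleftrightarrow> b \<in> V"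
      using W2[OF h[OF ab]] W2[OF pair_graphD(5)[OF F(1) h[OF ab]]] pair_graphD(3,4)[OF F'(1) ab]
      by (auto simp: V_def)
    moreover have "(a, b) \<in> E" if "a \<in> V" using that ab by (simp add: E_def V_def)
    ultimately show ?thesis using X(2)[of a b] by (auto simp: Y_def)
  qed
  ultimately show ?thesis unfolding twist_solution_def by (intro exI[of _ Y]) blast
qed

text \<open>The vertices of a cycle through \<open>s\<close> form the core, since each has two
  distinct neighbours on the cycle and at most one of them is the excluded \<open>v\<close>.\<close>

lemma cycle_solvable:
  assumes F: "pair_graph F" "\<not> forest_rel (parcs F)"
  shows "\<exists>s t. (s, t) \<in> parcs F \<and> (\<forall>F' \<phi>. pair_graph F' \<and> forest_rel (parcs F') \<and> \<phi> \<in> homs F' F \<longrightarrow>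
    (\<exists>X. twist_solution F {s} (F' :: nat pair_pre_digraph) \<phi> X))"
proof -
  obtain b p where p: "p \<noteq> []" "hd p \<noteq> last p" "distinct (b # p)"
    "successively (\<lambda>x y. (x, y) \<in> parcs F) (b # p @ [b])"
    using exists_cycle[OF pair_graphD(2,5,6)[OF F(1)] F(2)] by blast
  let ?Z = "set (b # p)"
  have core: "\<exists>u \<in> ?Z. (z, u) \<in> parcs F \<and> u \<noteq> v" if z: "z \<in> ?Z" for z v
  proof -
    have "\<exists>x \<in> ?Z. \<exists>y \<in> ?Z. x \<noteq> y \<and> (x, z) \<in> parcs F \<and> (z, y) \<in> parcs F"
    proof (cases "z = b")
      case True
      then show ?thesis using p(1,2,4)
        by (intro bexI[of _ "last p"] bexI[of _ "hd p"])
          (auto simp: successively_append_iff successively_Cons)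
    next
      case False
      then obtain q r where q: "p = q @ z # r" using z split_list[of z p] by auto
      \<comment> \<open>The predecessor and successor of \<open>z\<close> on the cycle, with
        \<open>b\<close> filling in at the ends of \<open>p\<close>. They could coincide only if
        \<open>p\<close> were a single vertex.\<close>
      define x y where "x = last (b # q)" and "y = hd (r @ [b])"
      have "(x, z) \<in> parcs F" "(z, y) \<in> parcs F"
        using p(4) unfolding q x_def y_def
        by (auto simp: successively_append_iff successively_Cons)
      moreover have "x \<in> ?Z" "y \<in> ?Z" unfolding x_def y_def q by (cases r; auto)+
      moreover have "x \<noteq> y"
        using p(2,3) unfolding x_def y_def q by (cases r; cases q rule: rev_cases; auto)
      ultimately show ?thesis by blast
    qed
    then show ?thesis using pair_graphD(5)[OF F(1)] by metis
  qed
  obtain t where t: "(b, t) \<in> parcs F" using core[of b] by auto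
  have "\<exists>X. twist_solution F {b} F' \<phi> X"
    if F': "pair_graph F'" "forest_rel (parcs F')" "\<phi> \<in> homs F' F" for F' :: "nat pair_pre_digraph" and \<phi>
  proof -
    interpret forest_rel "parcs F'" by fact
    have "\<exists>X. (\<forall>x \<in> pverts F'. X x \<subseteq> nbrs F (\<phi> x) \<and> (odd (card (X x)) \<longleftrightarrow> \<phi> x = b)) \<and>
      (\<forall>x \<in> pverts F'. \<forall>y \<in> pverts F'. (x, y) \<in> parcs F' \<longrightarrow> (\<phi> y \<in> X x \<longleftrightarrow> \<phi> x \<in> X y))"
    proof (rule parity_system_solvable_core[where Z = ?Z])
      show "(\<phi> x, \<phi> y) \<in> parcs F" if "(x, y) \<in> parcs F'" for x y
        using F'(3) that unfolding homs_def by blast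
    qed (use core pair_graphD(1)[OF F'(1)] pair_graphD(5)[OF F(1)] in simp_all)
    then obtain X where "\<forall>x \<in> pverts F'. X x \<subseteq> nbrs F (\<phi> x) \<and> (odd (card (X x)) \<longleftrightarrow> \<phi> x = b)"
      "\<forall>x \<in> pverts F'. \<forall>y \<in> pverts F'. (x, y) \<in> parcs F' \<longrightarrow> (\<phi> y \<in> X x \<longleftrightarrow> \<phi> x \<in> X y)"
      by blast
    then show ?thesis
      using pair_graphD(3,4)[OF F'(1)] unfolding twist_solution_def by (intro exI[of _ X]) auto
  qed
  then show ?thesis using t by blast
qed

section \<open>Graph pairs that distinguish \<open>F\<close> from the class\<close>

lemma simple_graph_cfi:
  assumes "pair_graph F" "(s, t) \<in> parcs F"
  shows "simple_graph (cfi F {})" "simple_graph (cfi F {s})"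
proof -
  \<comment> \<open>An odd label over \<open>s\<close> requires a neighbour, hence the assumption of
    an edge at \<open>s\<close>.\<close>
  have "enc s {} \<in> pverts (cfi F {})" "enc s {t} \<in> pverts (cfi F {s})"
    using pair_graphD(3)[OF assms] assms(2) by (auto simp: pverts_cfi)
  then show "simple_graph (cfi F {})" "simple_graph (cfi F {s})"
    using pair_graph_cfi[OF assms(1)] unfolding simple_graph_def by blast+
qed

lemma cfi_distinguishes:
  assumes F: "pair_graph F" "(s, t) \<in> parcs F" and C: "\<And>F'. F' \<in> C \<Longrightarrow> pair_graph F'"
    and "\<And>F' \<phi>. F' \<in> C \<Longrightarrow> \<phi> \<in> homs F' F \<Longrightarrow> \<exists>X. twist_solution F {s} F' \<phi> X"
  shows "\<exists>G H. simple_graph G \<and> simple_graph H \<and> hom_indistinguishable C G H \<and>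
    hom_count F G \<noteq> hom_count F H"
proof (intro exI conjI)
  show "simple_graph (cfi F {})" "simple_graph (cfi F {s})" using simple_graph_cfi[OF F] by auto
  show "hom_indistinguishable C (cfi F {}) (cfi F {s})"
    using hom_count_cfi_eq[OF F(1) C] assms(4) unfolding hom_indistinguishable_def by metis
  show "hom_count F (cfi F {}) \<noteq> hom_count F (cfi F {s})"
    using hom_count_cfi_less[OF F(1) pair_graphD(3)[OF F]] by simp
qed

text \<open>For the empty class and an edgeless \<open>F\<close> there is no edge at which to twist;
  edgeless targets with one and two vertices already give different powers.\<close>

lemma edgeless_distinguished:
  assumes "simple_graph F" "parcs F = {}"
  shows "\<exists>(G :: nat pair_pre_digraph) (H :: nat pair_pre_digraph). simple_graph G \<and> simple_graph H \<and> hom_count F G \<noteq> hom_count F H"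
proof -
  define G where "G = (\<lambda>n. \<lparr> pverts = {..<n}, parcs = {} \<rparr> :: nat pair_pre_digraph)"
  have "simple_graph (G 1)" "simple_graph (G 2)"
    unfolding simple_graph_def G_def by (auto intro!: pair_graphI simp: lessThan_empty_iff)
  have F: "finite (pverts F)" "pverts F \<noteq> {}"
    using assms(1) pair_graphD(1) unfolding simple_graph_def by auto
  have "hom_count F (G n) = n ^ card (pverts F)" for n
    using F(1) assms(2) by (simp add: hom_count_def homs_def G_def card_PiE)
  moreover have "(1 :: nat) ^ card (pverts F) \<noteq> 2 ^ card (pverts F)"
    using F one_less_power[of "2 :: nat" "card (pverts F)"] by (simp add: card_gt_0_iff)
  ultimately have "hom_count F (G 1) \<noteq> hom_count F (G 2)" by simp
  with \<open>simple_graph (G 1)\<close> \<open>simple_graph (G 2)\<close> show ?thesis by blast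
qed

lemma singleton_topological_minor:
  assumes "pverts F \<noteq> {}"
  shows "topological_minor \<lparr> pverts = {s}, parcs = {} \<rparr> F"
proof -
  obtain a where "a \<in> pverts F" using assms by blast
  then show ?thesis unfolding topological_minor_def by (intro exI[of _ "\<lambda>_. a"]) simp
qed

theorem theorem1p5:
  fixes C :: "nat pair_pre_digraph set"
  assumes "\<forall>F \<in> C. forest_graph F"
    and "union_closed C"
    and "topological_minor_closed C"
  shows "hom_distinguishing_closed C"
  unfolding hom_distinguishing_closed_def
proof (intro allI impI)
  fix F :: "nat pair_pre_digraph" assume F: "simple_graph F \<and> F \<notin> C"
  have C: "pair_graph F'" "pverts F' \<noteq> {}" "forest_rel (parcs F')" if "F' \<in> C" for F'
    using that assms(1) forest_graph_forest_rel[of F'] by (auto simp: forest_graph_def simple_graph_def)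
  have pF: "pair_graph F" using F unfolding simple_graph_def by blast
  show "\<exists>G H. simple_graph G \<and> simple_graph H \<and> hom_indistinguishable C G H \<and>
      hom_count F G \<noteq> hom_count F H"
  proof (cases "C = {}")
    case True
    show ?thesis
    proof (cases "parcs F = {}")
      case True
      then show ?thesis
        using edgeless_distinguished[of F] F \<open>C = {}\<close> unfolding hom_indistinguishable_def by blast
    next
      case False
      then obtain s t where "(s, t) \<in> parcs F" by auto
      then show ?thesis using cfi_distinguishes[OF pF, of s t C] \<open>C = {}\<close> by blast
    qed
  next
    case ne: False
    show ?thesis
    proof (cases "forest_rel (parcs F)")
      case True
      obtain W where W: "W \<noteq> {}" "adj_closed F W" "induced F W \<notin> C"
        "\<And>S. S \<noteq> {} \<Longrightarrow> S \<subseteq> W \<Longrightarrow> adj_closed F S \<Longrightarrow> S = W"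
        using exists_minimal_closed[of F C] F assms(2) by blast
      have W1: "W \<subseteq> pverts F" using W(2) unfolding adj_closed_def by blast
      have "simple_graph (induced F W)"
        using pair_graph_induced[OF pF W1] W(1) by (simp add: simple_graph_def)
      then have minor: "\<not> topological_minor (induced F W) F'" if "F' \<in> C" for F'
        using that W(3) assms(3) unfolding topological_minor_closed_def by blast
      obtain s where s: "s \<in> W" using W(1) by blast
      \<comment> \<open>An isolated \<open>s\<close> would make the component a single vertex, which
        is a topological minor of every member of the nonempty class.\<close>
      have "\<exists>t. (s, t) \<in> parcs F"
      proof (rule ccontr)
        assume iso: "\<nexists>t. (s, t) \<in> parcs F"
        then have "{s} = W" using s W1 by (intro W(4)) (auto simp: adj_closed_def)
        then have "induced F W = \<lparr> pverts = {s}, parcs = {} \<rparr>"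
          using iso by (auto simp: induced_def)
        then show False using singleton_topological_minor ne C(2) minor by (metis ex_in_conv)
      qed
      then obtain t where "(s, t) \<in> parcs F" by blast
      then show ?thesis
        using cfi_distinguishes[OF pF, of s t C] C minor
          tree_solvable[OF pF True _ _ W(2) s W(4)] by blast
    next
      case False
      obtain s t where "(s, t) \<in> parcs F" and
        "\<And>F' \<phi>. pair_graph F' \<Longrightarrow> forest_rel (parcs F') \<Longrightarrow> \<phi> \<in> homs F' F \<Longrightarrow>
          \<exists>X. twist_solution F {s} (F' :: nat pair_pre_digraph) \<phi> X"
        using cycle_solvable[OF pF False] by blast
      then show ?thesis using cfi_distinguishes[OF pF, of s t C] C by blast
    qed
  qed
qed

end
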